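(* Let $k,l$ be positive integers, $n=k+l$, and let $\mu,\nu,\lambda$ be partitions with $\mu,\nu,\lambda\subseteq(k^l)$. Assume $\mu\subseteq\bigl((k^l)/\nu\bigr)^\circ$ and $\mu\neq\bigl((k^l)/\nu\bigr)^\circ$. Then the coefficient of $\sigma_\lambda$ in the decomposition of the product $\sigma_\mu\cdot\sigma_\nu$ of Schubert classes in $H^*(Gr(l,\mathbb{C}^n),\mathbb{Z})$ equals the coefficient of the irreducible character $\bigl[((k^l)/\lambda)^\circ\bigr]$ in the decomposition of the skew character $\bigl[((k^l)/\nu)^\circ/\mu\bigr]$.
   Context: A partition is a weakly decreasing finite sequence of non-negative integers, identified with its diagram of left-justified boxes; $(k^l)$ is the partition with $l$ parts equal to $k$, i.e. the rectangle with $l$ rows and $k$ columns. For $\mu\subseteq\lambda$, $\lambda/\mu$ is the difference of the sets of boxes, and $(\lambda/\mu)^\circ$ is its rotation by $180^\circ$, well defined up to translation. For $\nu\subseteq(k^l)$, $((k^l)/\nu)^\circ$ is (the diagram of) the partition $(k-\nu_l,k-\nu_{l-1},\ldots,k-\nu_1)$. The Littlewood-Richardson coefficient $c(\lambda;\mu,\nu)$ is the number of semistandard tableaux of shape $\lambda/\mu$ with content $\nu$ (rows weakly increasing, columns strictly increasing, $\nu_i$ entries equal to $i$) whose reverse row word (read right to left in each row, rows from top to bottom) is a lattice word (every initial segment contains at least as many $i$'s as $(i+1)$'s for all $i\ge1$); it is $0$ if $\mu\not\subseteq\lambda$. The irreducible characters of the symmetric group $S_m$ are denoted $[\alpha]$,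 $\alpha$ a partition of $m$, and the skew character is $[\lambda/\mu]=\sum_\alpha c(\lambda;\mu,\alpha)[\alpha]$. $Gr(l,\mathbb{C}^n)$ is the Grassmannian of $l$-dimensional subspaces of $\mathbb{C}^n$. Its integral cohomology ring has an additive basis of Schubert classes $\sigma_\lambda$ indexed by partitions $\lambda\subseteq(k^l)$, $k=n-l$, with multiplication $\sigma_\mu\cdot\sigma_\nu=\sum_{\lambda\subseteq(k^l)}c(\lambda;\mu,\nu)\,\sigma_\lambda$. *)

theory Defs
  imports
    "HOL-Homology.Homology"
    "HOL-Algebra.QuotRing"
    "HOL-Algebra.Sym_Groups"
    "Jordan_Normal_Form.Matrix"
begin

section \<open>Partitions\<close>

text \<open>A partition is a weakly decreasing function on the natural numbers that is eventually zero;
  its value at \<open>i\<close> is the part with number \<open>i + 1\<close>. Sequences differing only by trailing zeros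
  are thereby identified. Rows and columns of diagrams are numbered from \<open>0\<close>.\<close>

type_synonym ptn = "nat \<Rightarrow> nat"

definition is_partition :: "ptn \<Rightarrow> bool" where
  "is_partition \<alpha> \<longleftrightarrow> antimono \<alpha> \<and> finite {i. \<alpha> i \<noteq> 0}"

definition diagram :: "ptn \<Rightarrow> (nat \<times> nat) set" where
  "diagram \<alpha> = {(i, j). j < \<alpha> i}"

definition skew_diagram :: "ptn \<Rightarrow> ptn \<Rightarrow> (nat \<times> nat) set" where
  "skew_diagram \<Lambda> \<mu> = diagram \<Lambda> - diagram \<mu>"

definition num_rows :: "ptn \<Rightarrow> nat" where
  "num_rows \<alpha> = card {i. \<alpha> i \<noteq> 0}"

definition partitions_of :: "nat \<Rightarrow> ptn set" where
  "partitions_of m = {\<alpha>. is_partition \<alpha> \<and> card (diagram \<alpha>) = m}"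

definition conjugate_ptn :: "ptn \<Rightarrow> ptn" where
  "conjugate_ptn \<alpha> j = card {i. j < \<alpha> i}"

text \<open>The rectangle \<open>(k\<^sup>l)\<close> has \<open>l\<close> rows and \<open>k\<close> columns.\<close>

definition rect :: "nat \<Rightarrow> nat \<Rightarrow> ptn" where
  "rect k l i = (if i < l then k else 0)"

definition partitions_in_rect :: "nat \<Rightarrow> nat \<Rightarrow> ptn set" where
  "partitions_in_rect k l = {\<alpha>. is_partition \<alpha> \<and> diagram \<alpha> \<subseteq> diagram (rect k l)}"

text \<open>\<open>((k\<^sup>l)/\<nu>)\<degree> = (k - \<nu>\<^sub>l, \<dots>, k - \<nu>\<^sub>1)\<close>; only used for \<open>\<nu>\<close> contained in \<open>(k\<^sup>l)\<close>, where the
  subtraction does not truncate.\<close>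

definition rect_compl :: "nat \<Rightarrow> nat \<Rightarrow> ptn \<Rightarrow> ptn" where
  "rect_compl k l \<nu> i = (if i < l then k - \<nu> (l - 1 - i) else 0)"


section \<open>Littlewood-Richardson coefficients\<close>

text \<open>Tableaux have positive entries and are extended by \<open>0\<close> outside their shape.\<close>

definition semistandard_tableaux :: "ptn \<Rightarrow> ptn \<Rightarrow> (nat \<times> nat \<Rightarrow> nat) set" where
  "semistandard_tableaux \<Lambda> \<mu> = {T.
     (\<forall>b. b \<in> skew_diagram \<Lambda> \<mu> \<longleftrightarrow> T b \<noteq> 0) \<and>
     (\<forall>i j j'. (i, j) \<in> skew_diagram \<Lambda> \<mu> \<and> (i, j') \<in> skew_diagram \<Lambda> \<mu> \<and> j \<le> j'
        \<longrightarrow> T (i, j) \<le> T (i, j')) \<and>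
     (\<forall>i i' j. (i, j) \<in> skew_diagram \<Lambda> \<mu> \<and> (i', j) \<in> skew_diagram \<Lambda> \<mu> \<and> i < i'
        \<longrightarrow> T (i, j) < T (i', j))}"

definition has_content :: "ptn \<Rightarrow> ptn \<Rightarrow> (nat \<times> nat \<Rightarrow> nat) \<Rightarrow> ptn \<Rightarrow> bool" where
  "has_content \<Lambda> \<mu> T \<nu> \<longleftrightarrow> (\<forall>i. card {b \<in> skew_diagram \<Lambda> \<mu>. T b = Suc i} = \<nu> i)"

definition reverse_row_word :: "ptn \<Rightarrow> ptn \<Rightarrow> (nat \<times> nat \<Rightarrow> nat) \<Rightarrow> nat list" where
  "reverse_row_word \<Lambda> \<mu> T =
     concat (map (\<lambda>i. map (\<lambda>j. T (i, j)) (rev [\<mu> i..<\<Lambda> i])) [0..<num_rows \<Lambda>])"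

definition lattice_word :: "nat list \<Rightarrow> bool" where
  "lattice_word w \<longleftrightarrow>
     (\<forall>n. \<forall>i\<ge>1. count_list (take n w) (i + 1) \<le> count_list (take n w) i)"

definition lr_coeff :: "ptn \<Rightarrow> ptn \<Rightarrow> ptn \<Rightarrow> nat" where
  "lr_coeff \<Lambda> \<mu> \<nu> =
     (if diagram \<mu> \<subseteq> diagram \<Lambda>
      then card {T \<in> semistandard_tableaux \<Lambda> \<mu>.
                   has_content \<Lambda> \<mu> T \<nu> \<and> lattice_word (reverse_row_word \<Lambda> \<mu> T)}
      else 0)"


section \<open>Coefficients in a decomposition\<close>

text \<open>\<open>comb a\<close> stands for the linear combination, with integer coefficients \<open>a\<close>, of a linearly
  independent family indexed by \<open>I\<close>. Coefficients at indices outside \<open>I\<close> are \<open>0\<close>.\<close>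

definition int_families :: "'i set \<Rightarrow> ('i \<Rightarrow> int) set" where
  "int_families I = {a. \<forall>i. i \<notin> I \<longrightarrow> a i = 0}"

definition coeff_in :: "(('i \<Rightarrow> int) \<Rightarrow> 'v) \<Rightarrow> 'i set \<Rightarrow> 'v \<Rightarrow> 'i \<Rightarrow> int" where
  "coeff_in comb I x = (THE a. a \<in> int_families I \<and> comb a = x)"


section \<open>Characters of symmetric groups\<close>

text \<open>A matrix representation of degree \<open>d\<close> of the symmetric group on \<open>{1..m}\<close>.\<close>

definition sym_matrix_rep ::
  "nat \<Rightarrow> nat \<Rightarrow> ((nat \<Rightarrow> nat) \<Rightarrow> complex Matrix.mat) \<Rightarrow> bool" where
  "sym_matrix_rep m d \<rho> \<longleftrightarrow>
     (\<forall>p \<in> carrier (sym_group m). \<rho> p \<in> carrier_mat d d) \<and>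
     \<rho> id = 1\<^sub>m d \<and>
     (\<forall>p \<in> carrier (sym_group m). \<forall>q \<in> carrier (sym_group m). \<rho> (p \<circ> q) = \<rho> p * \<rho> q)"

definition complex_subspace :: "nat \<Rightarrow> complex Matrix.vec set \<Rightarrow> bool" where
  "complex_subspace d W \<longleftrightarrow> W \<subseteq> carrier_vec d \<and> 0\<^sub>v d \<in> W \<and>
     (\<forall>v \<in> W. \<forall>w \<in> W. v + w \<in> W) \<and> (\<forall>c. \<forall>v \<in> W. c \<cdot>\<^sub>v v \<in> W)"

definition irreducible_rep ::
  "nat \<Rightarrow> nat \<Rightarrow> ((nat \<Rightarrow> nat) \<Rightarrow> complex Matrix.mat) \<Rightarrow> bool" where
  "irreducible_rep m d \<rho> \<longleftrightarrow> sym_matrix_rep m d \<rho> \<and> d > 0 \<and>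
     (\<forall>W. complex_subspace d W \<and> (\<forall>p \<in> carrier (sym_group m). \<forall>w \<in> W. \<rho> p *\<^sub>v w \<in> W)
        \<longrightarrow> W = {0\<^sub>v d} \<or> W = carrier_vec d)"

text \<open>Characters are extended by \<open>0\<close> to all functions on the natural numbers.\<close>

definition rep_character ::
  "nat \<Rightarrow> nat \<Rightarrow> ((nat \<Rightarrow> nat) \<Rightarrow> complex Matrix.mat) \<Rightarrow> (nat \<Rightarrow> nat) \<Rightarrow> complex" where
  "rep_character m d \<rho> p =
     (if p \<in> carrier (sym_group m) then (\<Sum>i<d. \<rho> p $$ (i, i)) else 0)"

definition irreducible_characters :: "nat \<Rightarrow> ((nat \<Rightarrow> nat) \<Rightarrow> complex) set" where
  "irreducible_characters m = {rep_character m d \<rho> | d \<rho>. irreducible_rep m d \<rho>}"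

text \<open>The Young subgroup \<open>S\<^sub>\<alpha>\<close> preserves the consecutive blocks of \<open>\<alpha>\<^sub>1, \<alpha>\<^sub>2, \<dots>\<close> elements.\<close>

definition young_block :: "ptn \<Rightarrow> nat \<Rightarrow> nat set" where
  "young_block \<alpha> r = {(\<Sum>i<r. \<alpha> i) <.. (\<Sum>i\<le>r. \<alpha> i)}"

definition young_subgroup :: "nat \<Rightarrow> ptn \<Rightarrow> (nat \<Rightarrow> nat) set" where
  "young_subgroup m \<alpha> =
     {p \<in> carrier (sym_group m). \<forall>r. p ` young_block \<alpha> r = young_block \<alpha> r}"

text \<open>The standard labelling \<open>\<alpha> \<mapsto> [\<alpha>]\<close> of the irreducible characters: \<open>[\<alpha>]\<close> is the unique common
  irreducible constituent of the trivial character of \<open>S\<^sub>\<alpha>\<close> and the sign character of the Young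
  subgroup of the conjugate of \<open>\<alpha>\<close>, both induced to the full symmetric group. By Frobenius
  reciprocity, being a constituent means that the sums below do not vanish.\<close>

definition irr_char_labelling :: "(ptn \<Rightarrow> (nat \<Rightarrow> nat) \<Rightarrow> complex) \<Rightarrow> bool" where
  "irr_char_labelling chi \<longleftrightarrow>
     (\<forall>m. bij_betw chi (partitions_of m) (irreducible_characters m) \<and>
       (\<forall>\<alpha> \<in> partitions_of m.
          (\<Sum>p \<in> young_subgroup m \<alpha>. chi \<alpha> p) \<noteq> 0 \<and>
          (\<Sum>p \<in> young_subgroup m (conjugate_ptn \<alpha>). of_int (sign p) * chi \<alpha> p) \<noteq> 0))"

text \<open>\<open>[\<Lambda>/\<mu>]\<close> as a function on permutations. The sum over all partitions \<open>\<alpha>\<close> only involves those of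
  the size of \<open>\<Lambda>/\<mu>\<close>, as \<open>c(\<Lambda>; \<mu>, \<alpha>) = 0\<close> for all others.\<close>

definition skew_character ::
  "(ptn \<Rightarrow> (nat \<Rightarrow> nat) \<Rightarrow> complex) \<Rightarrow> ptn \<Rightarrow> ptn \<Rightarrow> (nat \<Rightarrow> nat) \<Rightarrow> complex" where
  "skew_character chi \<Lambda> \<mu> p =
     (\<Sum>\<alpha> \<in> partitions_of (card (skew_diagram \<Lambda> \<mu>)). of_nat (lr_coeff \<Lambda> \<mu> \<alpha>) * chi \<alpha> p)"

text \<open>Coefficient of \<open>[\<beta>]\<close> in a virtual character of the symmetric group on \<open>{1..m}\<close>; it is \<open>0\<close> if
  \<open>\<beta>\<close> is not a partition of \<open>m\<close>.\<close>

definition character_coeff ::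
  "(ptn \<Rightarrow> (nat \<Rightarrow> nat) \<Rightarrow> complex) \<Rightarrow> nat \<Rightarrow> ((nat \<Rightarrow> nat) \<Rightarrow> complex) \<Rightarrow> ptn \<Rightarrow> int" where
  "character_coeff chi m =
     coeff_in (\<lambda>a p. \<Sum>\<alpha> \<in> partitions_of m. of_int (a \<alpha>) * chi \<alpha> p) (partitions_of m)"


section \<open>Integral singular cohomology ring\<close>

text \<open>A cochain assigns an integer \<open>c p f\<close> to every singular \<open>p\<close>-simplex \<open>f\<close>; inhomogeneous cochains
  with finitely many nonzero degrees are allowed, so that the cohomology ring is the direct sum of
  the cohomology groups.\<close>

type_synonym 'a cochain = "nat \<Rightarrow> ((nat \<Rightarrow> real) \<Rightarrow> 'a) \<Rightarrow> int"

definition cochains :: "'a topology \<Rightarrow> 'a cochain set" where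
  "cochains X = {c. (\<forall>p f. \<not> singular_simplex p X f \<longrightarrow> c p f = 0) \<and>
                    finite {p. \<exists>f. c p f \<noteq> 0}}"

definition coboundary :: "'a topology \<Rightarrow> 'a cochain \<Rightarrow> 'a cochain" where
  "coboundary X c p f =
     (if p \<noteq> 0 \<and> singular_simplex p X f
      then \<Sum>i\<le>p. (- 1) ^ i * c (p - 1) (singular_face p i f) else 0)"

text \<open>Restrictions of a simplex to its first \<open>p + 1\<close> vertices, and to the \<open>q + 1\<close> vertices starting
  with number \<open>p\<close>.\<close>

definition front_face :: "nat \<Rightarrow> ((nat \<Rightarrow> real) \<Rightarrow> 'a) \<Rightarrow> (nat \<Rightarrow> real) \<Rightarrow> 'a" where
  "front_face p f = restrict f (standard_simplex p)"

definition back_face :: "nat \<Rightarrow> nat \<Rightarrow> ((nat \<Rightarrow> real) \<Rightarrow> 'a) \<Rightarrow> (nat \<Rightarrow> real) \<Rightarrow> 'a" where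
  "back_face p q f =
     restrict (\<lambda>x. f (\<lambda>i. if i < p then 0 else x (i - p))) (standard_simplex q)"

definition cup :: "'a topology \<Rightarrow> 'a cochain \<Rightarrow> 'a cochain \<Rightarrow> 'a cochain" where
  "cup X c d p f =
     (if singular_simplex p X f
      then \<Sum>q\<le>p. c q (front_face q f) * d (p - q) (back_face q (p - q) f) else 0)"

definition cocycle_ring :: "'a topology \<Rightarrow> 'a cochain ring" where
  "cocycle_ring X =
     \<lparr>carrier = {c \<in> cochains X. coboundary X c = (\<lambda>p f. 0)},
      monoid.mult = cup X,
      one = (\<lambda>p f. if p = 0 \<and> singular_simplex 0 X f then 1 else 0),
      zero = (\<lambda>p f. 0),
      add = (\<lambda>c d p f. c p f + d p f)\<rparr>"

definition coboundaries :: "'a topology \<Rightarrow> 'a cochain set" where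
  "coboundaries X = coboundary X ` cochains X"

definition cohomology_ring :: "'a topology \<Rightarrow> 'a cochain set ring" where
  "cohomology_ring X = cocycle_ring X Quot coboundaries X"

definition homogeneous_class :: "nat \<Rightarrow> 'a cochain set \<Rightarrow> bool" where
  "homogeneous_class p x \<longleftrightarrow> (\<exists>c \<in> x. \<forall>q f. q \<noteq> p \<longrightarrow> c q f = 0)"

definition restrict_cochain :: "'a topology \<Rightarrow> 'a cochain \<Rightarrow> 'a cochain" where
  "restrict_cochain Y c p f = (if singular_simplex p Y f then c p f else 0)"

text \<open>The class maps to \<open>0\<close> in the cohomology ring of the subspace \<open>S\<close>.\<close>

definition vanishes_on :: "'a topology \<Rightarrow> 'a set \<Rightarrow> 'a cochain set \<Rightarrow> bool" where
  "vanishes_on X S x \<longleftrightarrow>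
     (\<exists>c \<in> x. restrict_cochain (subtopology X S) c \<in> coboundaries (subtopology X S))"


section \<open>Grassmannians and Schubert classes\<close>

definition subspaces_of_dim :: "nat \<Rightarrow> (complex ^ 'n) set set" where
  "subspaces_of_dim l = {V. vec.subspace V \<and> vec.dim V = l}"

text \<open>Linearly independent \<open>l\<close>-tuples, as functions on \<open>{..<l}\<close>.\<close>

definition frames :: "nat \<Rightarrow> (nat \<Rightarrow> complex ^ 'n) set" where
  "frames l = {v \<in> extensional {..<l}. vec.span (v ` {..<l}) \<in> subspaces_of_dim l}"

text \<open>The quotient topology with respect to the map sending a frame to its span.\<close>

definition grassmannian :: "nat \<Rightarrow> (complex ^ 'n) set topology" where
  "grassmannian l = topology (\<lambda>U. U \<subseteq> subspaces_of_dim l \<and>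
     openin (subtopology (product_topology (\<lambda>_. euclidean) {..<l}) (frames l))
       {v \<in> frames l. vec.span (v ` {..<l}) \<in> U})"

lemma openin_grassmannian:
  fixes U :: "(complex ^ 'n) set set"
  shows "openin (grassmannian l) U \<longleftrightarrow> U \<subseteq> subspaces_of_dim l \<and>
     openin (subtopology (product_topology (\<lambda>_. euclidean) {..<l}) (frames l))
       {v \<in> frames l. vec.span (v ` {..<l}) \<in> U}"
proof -
  let ?F = "subtopology (product_topology (\<lambda>_. euclidean) {..<l}) (frames l :: (nat \<Rightarrow> complex ^ 'n) set)"
  let ?P = "\<lambda>U :: (complex ^ 'n) set set. {v \<in> frames l. vec.span (v ` {..<l}) \<in> U}"
  have "istopology (\<lambda>U. U \<subseteq> subspaces_of_dim l \<and> openin ?F (?P U))"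
    unfolding istopology_def
  proof (intro conjI allI impI)
    fix S T :: "(complex ^ 'n) set set"
    assume *: "S \<subseteq> subspaces_of_dim l \<and> openin ?F (?P S)"
      "T \<subseteq> subspaces_of_dim l \<and> openin ?F (?P T)"
    show "S \<inter> T \<subseteq> subspaces_of_dim l" using * by blast
    have "?P (S \<inter> T) = ?P S \<inter> ?P T" by blast
    with * show "openin ?F (?P (S \<inter> T))" by (metis (no_types, lifting) openin_Int)
  next
    fix K :: "(complex ^ 'n) set set set"
    assume *: "\<forall>S\<in>K. S \<subseteq> subspaces_of_dim l \<and> openin ?F (?P S)"
    show "\<Union> K \<subseteq> subspaces_of_dim l" using * by blast
    have "?P (\<Union> K) = \<Union> (?P ` K)" by blast
    with * show "openin ?F (?P (\<Union> K))" by (metis (no_types, lifting) imageE openin_Union)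
  qed
  then show ?thesis
    by (simp add: grassmannian_def)
qed

lemma topspace_grassmannian:
  "topspace (grassmannian l) = (subspaces_of_dim l :: (complex ^ 'n) set set)"
proof -
  let ?F = "subtopology (product_topology (\<lambda>_. euclidean) {..<l}) (frames l :: (nat \<Rightarrow> complex ^ 'n) set)"
  have "topspace ?F = frames l"
    by (auto simp: frames_def PiE_def)
  then have "openin ?F (frames l)"
    by (metis openin_topspace)
  moreover have "{v \<in> frames l. vec.span (v ` {..<l}) \<in> subspaces_of_dim l} =
      (frames l :: (nat \<Rightarrow> complex ^ 'n) set)"
    by (auto simp: frames_def)
  ultimately have "openin (grassmannian l) (subspaces_of_dim l :: (complex ^ 'n) set set)"
    by (simp add: openin_grassmannian)
  then show ?thesis
    by (metis openin_grassmannian openin_subset openin_topspace subset_antisym)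
qed

definition complete_flag :: "(nat \<Rightarrow> (complex ^ 'n) set) \<Rightarrow> bool" where
  "complete_flag F \<longleftrightarrow>
     (\<forall>j \<le> CARD('n). vec.subspace (F j) \<and> vec.dim (F j) = j) \<and>
     (\<forall>i j. i \<le> j \<and> j \<le> CARD('n) \<longrightarrow> F i \<subseteq> F j)"

text \<open>\<open>dim (V \<inter> F\<^bsub>k + i - \<alpha>\<^sub>i\<^esub>) \<ge> i\<close> for \<open>1 \<le> i \<le> l\<close>, of codimension \<open>|\<alpha>|\<close>.\<close>

definition schubert_variety ::
  "nat \<Rightarrow> nat \<Rightarrow> (nat \<Rightarrow> (complex ^ 'n) set) \<Rightarrow> ptn \<Rightarrow> (complex ^ 'n) set set" where
  "schubert_variety k l F \<alpha> =
     {V \<in> subspaces_of_dim l. \<forall>i<l. i + 1 \<le> vec.dim (V \<inter> F (k + (i + 1) - \<alpha> i))}"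

definition schubert_combination ::
  "nat \<Rightarrow> nat \<Rightarrow> (ptn \<Rightarrow> (complex ^ 'n) set cochain set) \<Rightarrow> (ptn \<Rightarrow> int)
     \<Rightarrow> (complex ^ 'n) set cochain set" where
  "schubert_combination k l \<sigma> a =
     finsum (cohomology_ring (grassmannian l))
       (\<lambda>\<alpha>. add_pow (cohomology_ring (grassmannian l)) (a \<alpha>) (\<sigma> \<alpha>))
       (partitions_in_rect k l)"

text \<open>The first condition says that \<open>\<sigma> \<alpha>\<close> is, up to sign, the class dual to the Schubert variety: by
  duality, the classes of degree \<open>2|\<alpha>|\<close> vanishing on the complement of this irreducible variety are
  the integer multiples of the dual class. The second condition says that the \<open>\<sigma> \<alpha>\<close> are an
  additive basis. The third one is the multiplication of Schubert classes; it also fixes the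
  signs, up to the factor \<open>(-1)\<^sup>|\<^sup>\<alpha>\<^sup>|\<close> that depends on orientation conventions.\<close>

definition schubert_classes ::
  "nat \<Rightarrow> nat \<Rightarrow> (ptn \<Rightarrow> (complex ^ 'n) set cochain set) \<Rightarrow> bool" where
  "schubert_classes k l \<sigma> \<longleftrightarrow>
     (\<forall>F. \<forall>\<alpha> \<in> partitions_in_rect k l. complete_flag F \<longrightarrow>
        {x \<in> carrier (cohomology_ring (grassmannian l)).
           homogeneous_class (2 * card (diagram \<alpha>)) x \<and>
           vanishes_on (grassmannian l) (subspaces_of_dim l - schubert_variety k l F \<alpha>) x}
        = range (\<lambda>z::int. add_pow (cohomology_ring (grassmannian l)) z (\<sigma> \<alpha>))) \<and>
     bij_betw (schubert_combination k l \<sigma>)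
       (int_families (partitions_in_rect k l)) (carrier (cohomology_ring (grassmannian l))) \<and>
     (\<forall>\<mu> \<in> partitions_in_rect k l. \<forall>\<nu> \<in> partitions_in_rect k l.
        \<sigma> \<mu> \<otimes>\<^bsub>cohomology_ring (grassmannian l)\<^esub> \<sigma> \<nu> =
        schubert_combination k l \<sigma>
          (\<lambda>\<alpha>. if \<alpha> \<in> partitions_in_rect k l then int (lr_coeff \<alpha> \<mu> \<nu>) else 0))"

definition schubert_coeff ::
  "nat \<Rightarrow> nat \<Rightarrow> (ptn \<Rightarrow> (complex ^ 'n) set cochain set) \<Rightarrow> (complex ^ 'n) set cochain set
     \<Rightarrow> ptn \<Rightarrow> int" where
  "schubert_coeff k l \<sigma> = coeff_in (schubert_combination k l \<sigma>) (partitions_in_rect k l)"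

end

theory Submission
  imports Defs "Jordan_Normal_Form.Spectral_Radius"
begin

text \<open>The coefficient of \<open>\<sigma>\<^sub>\<lambda>\<close> is \<open>c(\<lambda>; \<mu>, \<nu>)\<close> and that of the irreducible character is
  \<open>c(\<nu>\<^sup>\<or>; \<mu>, \<lambda>\<^sup>\<or>)\<close>, where \<open>\<alpha>\<^sup>\<or>\<close> denotes the rotated complement of \<open>\<alpha>\<close> in \<open>(k\<^sup>l)\<close>. The latter
  uses that the irreducible characters are linearly independent, by Schur orthogonality. So the
  theorem amounts to a symmetry of Littlewood-Richardson coefficients.

  For the symmetry, let \<open>H\<^sub>b\<close> be the matrix, indexed by the partitions in \<open>(k\<^sup>l)\<close>, with entry \<open>1\<close> at
  \<open>(\<alpha>, \<beta>)\<close> if \<open>\<beta>/\<alpha>\<close> is a horizontal strip of size \<open>b\<close>. These matrices commute, by the reflections of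
  Bender and Knuth, and complementation transposes them. Let \<open>S\<^sub>\<nu>\<close> be the determinant of the
  \<open>H\<^bsub>\<nu>\<^sub>i - i + j\<^esub>\<close>. Stembridge's sign-reversing involution shows \<open>S\<^sub>\<nu>(\<mu>, \<lambda>) = c(\<lambda>; \<mu>, \<nu>)\<close>; in particular
  the row of \<open>S\<^sub>\<nu>\<close> at the empty partition is the unit vector of \<open>\<nu>\<close>. Comparing the entries of
  \<open>S\<^sub>\<mu> S\<^sub>\<nu> = S\<^sub>\<nu> S\<^sub>\<mu>\<close> in that row gives \<open>S\<^sub>\<nu>(\<mu>, \<lambda>) = S\<^sub>\<mu>(\<nu>, \<lambda>)\<close>, whence
  \<open>S\<^sub>\<nu>(\<mu>, \<lambda>) = S\<^sub>\<mu>(\<nu>, \<lambda>) = S\<^sub>\<mu>(\<lambda>\<^sup>\<or>, \<nu>\<^sup>\<or>) = S\<^bsub>\<lambda>\<^sup>\<or>\<^esub>(\<mu>, \<nu>\<^sup>\<or>)\<close>.\<close>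

section \<open>Horizontal strips inside a rectangle\<close>

lemma diagram_subset_iff: "diagram \<alpha> \<subseteq> diagram \<beta> \<longleftrightarrow> (\<forall>i. \<alpha> i \<le> \<beta> i)"
proof
  assume *: "diagram \<alpha> \<subseteq> diagram \<beta>"
  show "\<forall>i. \<alpha> i \<le> \<beta> i"
  proof (rule ccontr)
    assume "\<not> ?thesis"
    then obtain i where "\<beta> i < \<alpha> i" by (auto simp: not_le)
    then have "(i, \<beta> i) \<in> diagram \<alpha>" by (simp add: diagram_def)
    with * show False by (auto simp: diagram_def)
  qed
qed (auto simp: diagram_def intro: less_le_trans)

lemma partitions_in_rect_iff:
  "\<alpha> \<in> partitions_in_rect k l \<longleftrightarrow> antimono \<alpha> \<and> (\<forall>i. \<alpha> i \<le> k) \<and> (\<forall>i\<ge>l. \<alpha> i = 0)"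
proof -
  have "finite {i. \<alpha> i \<noteq> 0}" if "\<forall>i\<ge>l. \<alpha> i = 0"
    by (rule finite_subset[of _ "{..<l}"]) (use that not_less in blast, simp)
  moreover have "(\<forall>i. \<alpha> i \<le> rect k l i) \<longleftrightarrow> (\<forall>i. \<alpha> i \<le> k) \<and> (\<forall>i\<ge>l. \<alpha> i = 0)"
    unfolding rect_def by (metis le_zero_eq not_less zero_le)
  ultimately show ?thesis
    by (auto simp: partitions_in_rect_def is_partition_def diagram_subset_iff)
qed

lemma finite_partitions_in_rect: "finite (partitions_in_rect k l)"
proof (rule finite_subset)
  show "partitions_in_rect k l \<subseteq> {f. \<forall>i. (i \<in> {..<l} \<longrightarrow> f i \<in> {..k}) \<and> (i \<notin> {..<l} \<longrightarrow> f i = 0)}"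
    by (auto simp: partitions_in_rect_iff)
  show "finite {f :: ptn. \<forall>i. (i \<in> {..<l} \<longrightarrow> f i \<in> {..k}) \<and> (i \<notin> {..<l} \<longrightarrow> f i = 0)}"
    by (rule finite_set_of_finite_funs) auto
qed

lemma zero_in_partitions_in_rect: "(\<lambda>_. 0) \<in> partitions_in_rect k l"
  by (auto simp: partitions_in_rect_iff antimono_def)

text \<open>The interlacing form of the condition that no two boxes of
  \<open>\<beta>/\<alpha>\<close> lie in one column.\<close>

definition horizontal_strip :: "ptn \<Rightarrow> ptn \<Rightarrow> bool" where
  "horizontal_strip \<alpha> \<beta> \<longleftrightarrow> (\<forall>i. \<alpha> i \<le> \<beta> i \<and> \<beta> (Suc i) \<le> \<alpha> i)"

lemma horizontal_stripD:
  assumes "horizontal_strip \<alpha> \<beta>"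
  shows "\<alpha> i \<le> \<beta> i" "\<beta> (Suc i) \<le> \<alpha> i"
  using assms by (auto simp: horizontal_strip_def)

lemma horizontal_strip_refl: "antimono \<alpha> \<Longrightarrow> horizontal_strip \<alpha> \<alpha>"
  by (auto simp: horizontal_strip_def antimono_def)

text \<open>Integer values allow differences of sizes to be compared with Jacobi-Trudi indices,
  which can be negative.\<close>

definition ptn_size :: "nat \<Rightarrow> ptn \<Rightarrow> int" where
  "ptn_size l \<alpha> = (\<Sum>i<l. int (\<alpha> i))"

text \<open>For \<open>r = 0\<close> and \<open>u = \<gamma> 0\<close> this is the reflection of Bender and Knuth: every part of \<open>\<beta>\<close> is
  reflected in the interval of values which it can take between \<open>\<alpha>\<close> and \<open>\<gamma>\<close>.\<close>

definition flip :: "nat \<Rightarrow> nat \<Rightarrow> ptn \<Rightarrow> ptn \<Rightarrow> ptn \<Rightarrow> ptn" where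
  "flip r u \<alpha> \<gamma> \<beta> i =
     (if i < r then \<beta> i
      else max (\<alpha> i) (\<gamma> (Suc i)) + (if i = r then u else min (\<gamma> i) (\<alpha> (i - 1))) - \<beta> i)"

text \<open>In general the rows above \<open>r\<close> are frozen, and the interval of row
  \<open>r\<close> ends at \<open>u\<close> instead of its natural end. The conditions on
  \<open>u\<close> keep the reflected part of that row compatible with both strip
  conditions.\<close>

locale flippable =
  fixes r u :: nat and \<alpha> \<gamma> \<beta> :: ptn
  assumes strips: "horizontal_strip \<alpha> \<beta>" "horizontal_strip \<beta> \<gamma>"
    and u: "\<beta> r \<le> u" "u \<le> \<gamma> r" "r = 0 \<or> u \<le> \<alpha> (r - 1)"
begin

abbreviation "upper i \<equiv> (if i = r then u else min (\<gamma> i) (\<alpha> (i - 1)))"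

lemma bounds: "max (\<alpha> i) (\<gamma> (Suc i)) \<le> \<beta> i" "r \<le> i \<Longrightarrow> \<beta> i \<le> upper i"
proof -
  show "max (\<alpha> i) (\<gamma> (Suc i)) \<le> \<beta> i"
    using strips by (auto simp: horizontal_strip_def)
  show "\<beta> i \<le> upper i" if "r \<le> i"
    using that u horizontal_stripD(1)[OF strips(2), of i] horizontal_stripD(2)[OF strips(1), of "i - 1"]
    by (cases i) auto
qed

lemma flip_bounds:
  "r \<le> i \<Longrightarrow> max (\<alpha> i) (\<gamma> (Suc i)) \<le> flip r u \<alpha> \<gamma> \<beta> i" "r \<le> i \<Longrightarrow> flip r u \<alpha> \<gamma> \<beta> i \<le> upper i"
  using bounds[of i] by (auto simp: flip_def)

lemma flip_strips:
  "horizontal_strip \<alpha> (flip r u \<alpha> \<gamma> \<beta>)" "horizontal_strip (flip r u \<alpha> \<gamma> \<beta>) \<gamma>"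
proof -
  have low: "\<alpha> i \<le> flip r u \<alpha> \<gamma> \<beta> i" "\<gamma> (Suc i) \<le> flip r u \<alpha> \<gamma> \<beta> i" for i
    using flip_bounds(1)[of i] bounds(1)[of i] by (cases "i < r"; auto simp: flip_def)+
  have up: "flip r u \<alpha> \<gamma> \<beta> i \<le> \<gamma> i" for i
    using flip_bounds(2)[of i] horizontal_stripD(1)[OF strips(2), of i] u(2)
    by (cases "i < r") (auto simp: flip_def split: if_splits)
  have up': "flip r u \<alpha> \<gamma> \<beta> (Suc i) \<le> \<alpha> i" for i
    using flip_bounds(2)[of "Suc i"] horizontal_stripD(2)[OF strips(1), of i] u(3)
    by (cases "Suc i < r") (auto simp: flip_def split: if_splits)
  show "horizontal_strip \<alpha> (flip r u \<alpha> \<gamma> \<beta>)" "horizontal_strip (flip r u \<alpha> \<gamma> \<beta>) \<gamma>"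
    using low up up' by (auto simp: horizontal_strip_def)
qed

text \<open>The ends of the intervals do not depend on \<open>\<beta>\<close>, so both reflections
  use the same intervals; by \<open>bounds\<close> and \<open>flip_bounds\<close> the subtraction of
  naturals does not truncate.\<close>

lemma flip_flip: "flip r u \<alpha> \<gamma> (flip r u \<alpha> \<gamma> \<beta>) = \<beta>"
proof
  fix i
  show "flip r u \<alpha> \<gamma> (flip r u \<alpha> \<gamma> \<beta>) i = \<beta> i"
    using bounds[of i] by (auto simp: flip_def)
qed

lemma flip_in_rect:
  assumes "\<gamma> \<in> partitions_in_rect k l"
  shows "flip r u \<alpha> \<gamma> \<beta> \<in> partitions_in_rect k l"
proof -
  have "antimono (flip r u \<alpha> \<gamma> \<beta>)"
    using flip_strips(1) by (intro decseq_SucI) (meson horizontal_stripD order_trans)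
  then show ?thesis
    using assms flip_strips(2) unfolding partitions_in_rect_iff
    by (metis horizontal_stripD(1) le_zero_eq order_trans)
qed

text \<open>A telescoping sum: the lower end in row \<open>i\<close> is the maximum and the upper
  end in row \<open>i + 1\<close> the minimum of the same two numbers \<open>\<alpha> i\<close> and
  \<open>\<gamma> (Suc i)\<close>. What remains is \<open>u\<close> at the start and one minimum at
  the end.\<close>

lemma sum_flip:
  assumes "r < n"
  shows "(\<Sum>i=r..<n. int (flip r u \<alpha> \<gamma> \<beta> i) + int (\<beta> i)) + int (min (\<gamma> n) (\<alpha> (n - 1))) =
    int u + (\<Sum>i=r..<n. int (\<alpha> i)) + (\<Sum>i=r..<n. int (\<gamma> (Suc i)))"
  using assms
proof (induction n)
  case (Suc n)
  have *: "int (flip r u \<alpha> \<gamma> \<beta> n) + int (\<beta> n) = int (max (\<alpha> n) (\<gamma> (Suc n))) + int (upper n)"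
    if "r \<le> n"
  proof -
    have "\<beta> n \<le> max (\<alpha> n) (\<gamma> (Suc n)) + upper n"
      using bounds(2)[OF that] by (rule trans_le_add2)
    then have "flip r u \<alpha> \<gamma> \<beta> n + \<beta> n = max (\<alpha> n) (\<gamma> (Suc n)) + upper n"
      using that by (simp add: flip_def)
    then show ?thesis by (metis of_nat_add)
  qed
  show ?case
  proof (cases "r = n")
    case True
    then show ?thesis using * by auto
  next
    case False
    then have "r < n" using Suc.prems by simp
    then show ?thesis using Suc.IH * by auto
  qed
qed simp

text \<open>The last minimum in \<open>sum_flip\<close> vanishes because
  \<open>\<gamma> l = 0\<close>. For \<open>r = 0\<close> and \<open>u = \<gamma> 0\<close> both
  corrections are zero, so the reflection exchanges the sizes of the two strips.\<close>

lemma ptn_size_flip: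
  assumes "r < l" "\<gamma> l = 0"
  shows "ptn_size l (flip r u \<alpha> \<gamma> \<beta>) + ptn_size l \<beta> = ptn_size l \<alpha> + ptn_size l \<gamma>
    + (int u - int (\<gamma> r)) + (\<Sum>i<r. 2 * int (\<beta> i) - int (\<alpha> i) - int (\<gamma> i))"
proof -
  have split: "ptn_size l f = (\<Sum>i<r. int (f i)) + (\<Sum>i=r..<l. int (f i))" for f
    using assms(1) sum.atLeastLessThan_concat[of 0 r l "\<lambda>i. int (f i)"]
    by (simp add: ptn_size_def atLeast0LessThan)
  have "(\<Sum>i=r..<l. int (\<gamma> (Suc i))) = (\<Sum>i=Suc r..<Suc l. int (\<gamma> i))"
    by (rule sum.shift_bounds_Suc_ivl[symmetric])
  also have "\<dots> = (\<Sum>i=Suc r..<l. int (\<gamma> i))" using assms by simp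
  also have "\<dots> = (\<Sum>i=r..<l. int (\<gamma> i)) - int (\<gamma> r)"
    using assms(1) by (simp add: sum.atLeast_Suc_lessThan)
  finally have g: "(\<Sum>i=r..<l. int (\<gamma> (Suc i))) = (\<Sum>i=r..<l. int (\<gamma> i)) - int (\<gamma> r)" .
  have "(\<Sum>i<r. int (flip r u \<alpha> \<gamma> \<beta> i)) = (\<Sum>i<r. int (\<beta> i))"
    by (simp add: flip_def)
  then show ?thesis
    using sum_flip[OF assms(1)] assms(2) g
    by (simp add: split sum.distrib sum_subtractf sum_distrib_left[symmetric])
qed

end

lemma flippable_0:
  "horizontal_strip \<alpha> \<beta> \<Longrightarrow> horizontal_strip \<beta> \<gamma> \<Longrightarrow> flippable 0 (\<gamma> 0) \<alpha> \<gamma> \<beta>"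
  by unfold_locales (auto simp: horizontal_strip_def)


section \<open>Counting chains of horizontal strips\<close>

context
  fixes k l :: nat
begin

text \<open>The entries of the matrix \<open>H\<^sub>b\<close>. Jacobi-Trudi indices may be
  negative, hence the integer \<open>b\<close>; for negative \<open>b\<close> the matrix is
  zero.\<close>

definition strip_count :: "int \<Rightarrow> ptn \<Rightarrow> ptn \<Rightarrow> int" where
  "strip_count b \<alpha> \<beta> = of_bool (\<alpha> \<in> partitions_in_rect k l \<and> \<beta> \<in> partitions_in_rect k l \<and>
     horizontal_strip \<alpha> \<beta> \<and> ptn_size l \<beta> - ptn_size l \<alpha> = b)"

definition strip_op :: "int \<Rightarrow> (ptn \<Rightarrow> int) \<Rightarrow> ptn \<Rightarrow> int" where
  "strip_op b f \<alpha> = (\<Sum>\<beta>\<in>partitions_in_rect k l. strip_count b \<alpha> \<beta> * f \<beta>)"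

text \<open>An entry of a product of these matrices. Written as a fold of operators, the product can
  be reordered by \<open>fold_multiset_equiv\<close>.\<close>

definition chain_count :: "int list \<Rightarrow> ptn \<Rightarrow> ptn \<Rightarrow> int" where
  "chain_count bs \<mu> \<Lambda> = foldr strip_op bs (\<lambda>\<alpha>. of_bool (\<alpha> = \<Lambda>)) \<mu>"

lemma chain_count_Nil: "chain_count [] \<mu> \<Lambda> = of_bool (\<mu> = \<Lambda>)"
  by (simp add: chain_count_def)

lemma chain_count_Cons:
  "chain_count (b # bs) \<mu> \<Lambda> = (\<Sum>\<beta>\<in>partitions_in_rect k l. strip_count b \<mu> \<beta> * chain_count bs \<beta> \<Lambda>)"
  by (simp add: chain_count_def strip_op_def)

text \<open>Each side counts the \<open>\<beta>\<close> between \<open>\<alpha>\<close> and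
  \<open>\<gamma>\<close> with prescribed strip sizes, and the reflection of Bender and Knuth is a
  bijection that exchanges the two sizes.\<close>

lemma strip_count_commute:
  assumes "l > 0"
  shows "(\<Sum>\<beta>\<in>partitions_in_rect k l. strip_count a \<alpha> \<beta> * strip_count b \<beta> \<gamma>) =
    (\<Sum>\<beta>\<in>partitions_in_rect k l. strip_count b \<alpha> \<beta> * strip_count a \<beta> \<gamma>)"
proof (cases "\<alpha> \<in> partitions_in_rect k l \<and> \<gamma> \<in> partitions_in_rect k l")
  case True
  define M where "M a b = {\<beta> \<in> partitions_in_rect k l. horizontal_strip \<alpha> \<beta> \<and> horizontal_strip \<beta> \<gamma> \<and>
    ptn_size l \<beta> - ptn_size l \<alpha> = a \<and> ptn_size l \<gamma> - ptn_size l \<beta> = b}" for a b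
  have sum_eq: "(\<Sum>\<beta>\<in>partitions_in_rect k l. strip_count a \<alpha> \<beta> * strip_count b \<beta> \<gamma>) = int (card (M a b))"
    for a b
  proof -
    have "(\<Sum>\<beta>\<in>partitions_in_rect k l. strip_count a \<alpha> \<beta> * strip_count b \<beta> \<gamma>) =
      (\<Sum>\<beta>\<in>partitions_in_rect k l. if \<beta> \<in> M a b then 1 else 0)"
      using True by (intro sum.cong) (auto simp: strip_count_def M_def)
    also have "\<dots> = int (card (M a b))"
      by (subst sum.inter_restrict[symmetric, OF finite_partitions_in_rect])
        (simp add: M_def Int_absorb1 subset_iff)
    finally show ?thesis .
  qed
  let ?f = "flip 0 (\<gamma> 0) \<alpha> \<gamma>"
  have g0: "\<gamma> l = 0" using True by (auto simp: partitions_in_rect_iff)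
  have maps: "?f \<beta> \<in> M b a" "?f (?f \<beta>) = \<beta>" if "\<beta> \<in> M a b" for a b \<beta>
  proof -
    interpret flippable 0 "\<gamma> 0" \<alpha> \<gamma> \<beta>
      using that by (intro flippable_0) (auto simp: M_def)
    show "?f \<beta> \<in> M b a"
      using ptn_size_flip[of l, OF assms g0] flip_strips flip_in_rect True that
      by (auto simp: M_def)
    show "?f (?f \<beta>) = \<beta>" by (rule flip_flip)
  qed
  have "bij_betw ?f (M a b) (M b a)"
    by (rule bij_betw_byWitness[where f' = ?f]) (use maps in auto)
  then show ?thesis by (simp add: sum_eq bij_betw_same_card)
qed (auto simp: strip_count_def)

lemma strip_op_commute:
  assumes "l > 0"
  shows "strip_op a \<circ> strip_op b = strip_op b \<circ> strip_op a"
proof (intro ext)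
  fix f \<alpha>
  have *: "strip_op a (strip_op b f) \<alpha> = (\<Sum>\<gamma>\<in>partitions_in_rect k l.
    (\<Sum>\<beta>\<in>partitions_in_rect k l. strip_count a \<alpha> \<beta> * strip_count b \<beta> \<gamma>) * f \<gamma>)" for a b
    unfolding strip_op_def sum_distrib_left sum_distrib_right
    by (subst sum.swap) (simp add: mult.assoc)
  show "(strip_op a \<circ> strip_op b) f \<alpha> = (strip_op b \<circ> strip_op a) f \<alpha>"
    by (simp add: * strip_count_commute[OF assms, of a])
qed

lemma chain_count_mset:
  assumes "l > 0" "mset bs = mset cs"
  shows "chain_count bs = chain_count cs"
proof -
  have "fold strip_op (rev bs) = fold strip_op (rev cs)"
    using assms by (intro fold_multiset_equiv) (auto intro: strip_op_commute)
  then show ?thesis by (simp add: fun_eq_iff chain_count_def foldr_conv_fold)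
qed

lemma chain_count_append:
  assumes "\<mu> \<in> partitions_in_rect k l"
  shows "chain_count (bs @ cs) \<mu> \<Lambda> =
    (\<Sum>\<kappa>\<in>partitions_in_rect k l. chain_count bs \<mu> \<kappa> * chain_count cs \<kappa> \<Lambda>)"
  using assms
proof (induction bs arbitrary: \<mu>)
  case Nil
  have "(\<Sum>\<kappa>\<in>partitions_in_rect k l. chain_count [] \<mu> \<kappa> * chain_count cs \<kappa> \<Lambda>) =
    (\<Sum>\<kappa>\<in>partitions_in_rect k l. if \<mu> = \<kappa> then chain_count cs \<kappa> \<Lambda> else 0)"
    by (intro sum.cong) (auto simp: chain_count_Nil)
  also have "\<dots> = chain_count cs \<mu> \<Lambda>"
    using Nil finite_partitions_in_rect by simp
  finally show ?case by simp
next
  case (Cons b bs)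
  then show ?case
    by (simp add: chain_count_Cons sum_distrib_left sum_distrib_right mult.assoc)
      (rule sum.swap)
qed

lemma chain_count_single:
  assumes "\<Lambda> \<in> partitions_in_rect k l"
  shows "chain_count [b] \<mu> \<Lambda> = strip_count b \<mu> \<Lambda>"
proof -
  have "chain_count [b] \<mu> \<Lambda> =
    (\<Sum>\<beta>\<in>partitions_in_rect k l. if \<beta> = \<Lambda> then strip_count b \<mu> \<beta> else 0)"
    unfolding chain_count_Cons by (intro sum.cong) (auto simp: chain_count_Nil)
  also have "\<dots> = strip_count b \<mu> \<Lambda>"
    using assms finite_partitions_in_rect by simp
  finally show ?thesis .
qed

section \<open>Complementation in the rectangle\<close>

lemma rect_compl_in_rect:
  assumes "\<alpha> \<in> partitions_in_rect k l"
  shows "rect_compl k l \<alpha> \<in> partitions_in_rect k l"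
proof -
  have "antimono (rect_compl k l \<alpha>)"
  proof (rule antimonoI)
    fix i j :: nat assume "i \<le> j"
    then have "\<alpha> (l - 1 - i) \<le> \<alpha> (l - 1 - j)" if "j < l"
      using assms that by (auto simp: partitions_in_rect_iff antimono_def)
    then show "rect_compl k l \<alpha> j \<le> rect_compl k l \<alpha> i"
      using \<open>i \<le> j\<close> by (auto simp: rect_compl_def)
  qed
  then show ?thesis by (auto simp: partitions_in_rect_iff rect_compl_def)
qed

lemma rect_compl_rect_compl:
  assumes "\<alpha> \<in> partitions_in_rect k l"
  shows "rect_compl k l (rect_compl k l \<alpha>) = \<alpha>"
  using assms by (auto simp: fun_eq_iff partitions_in_rect_iff rect_compl_def)

lemma ptn_size_rect_compl:
  assumes "\<alpha> \<in> partitions_in_rect k l"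
  shows "ptn_size l (rect_compl k l \<alpha>) = int k * int l - ptn_size l \<alpha>"
proof -
  have "ptn_size l (rect_compl k l \<alpha>) = (\<Sum>i<l. int k - int (\<alpha> (l - 1 - i)))"
    using assms by (simp add: ptn_size_def rect_compl_def partitions_in_rect_iff of_nat_diff)
  also have "\<dots> = int k * int l - (\<Sum>i<l. int (\<alpha> (l - 1 - i)))"
    by (simp add: sum_subtractf)
  also have "(\<Sum>i<l. int (\<alpha> (l - 1 - i))) = ptn_size l \<alpha>"
    unfolding ptn_size_def using sum.nat_diff_reindex[of "\<lambda>i. int (\<alpha> i)" l] by simp
  finally show ?thesis .
qed

lemma horizontal_strip_rect_compl:
  assumes "\<alpha> \<in> partitions_in_rect k l" "\<beta> \<in> partitions_in_rect k l" "horizontal_strip \<alpha> \<beta>"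
  shows "horizontal_strip (rect_compl k l \<beta>) (rect_compl k l \<alpha>)"
  unfolding horizontal_strip_def
proof (intro allI conjI)
  fix i
  show "rect_compl k l \<beta> i \<le> rect_compl k l \<alpha> i"
    using horizontal_stripD(1)[OF assms(3)] by (auto simp: rect_compl_def intro: diff_le_mono2)
  have "\<beta> (l - Suc i) \<le> \<alpha> (l - Suc (Suc i))" if "Suc i < l"
    using horizontal_stripD(2)[OF assms(3), of "l - Suc (Suc i)"] that by (simp add: Suc_diff_Suc)
  then show "rect_compl k l \<alpha> (Suc i) \<le> rect_compl k l \<beta> i"
    by (auto simp: rect_compl_def intro: diff_le_mono2)
qed

lemma strip_count_rect_compl:
  assumes "\<alpha> \<in> partitions_in_rect k l" "\<beta> \<in> partitions_in_rect k l"
  shows "strip_count b (rect_compl k l \<beta>) (rect_compl k l \<alpha>) = strip_count b \<alpha> \<beta>"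
proof -
  have "horizontal_strip (rect_compl k l \<beta>) (rect_compl k l \<alpha>) \<longleftrightarrow> horizontal_strip \<alpha> \<beta>"
    using horizontal_strip_rect_compl assms rect_compl_in_rect rect_compl_rect_compl by metis
  then show ?thesis
    using assms by (simp add: strip_count_def rect_compl_in_rect ptn_size_rect_compl)
qed

lemma bij_betw_rect_compl:
  "bij_betw (rect_compl k l) (partitions_in_rect k l) (partitions_in_rect k l)"
  by (rule bij_betw_byWitness[where f' = "rect_compl k l"])
    (auto simp: rect_compl_in_rect rect_compl_rect_compl)

text \<open>Complementation transposes every factor, and transposing a product reverses the order of
  its factors.\<close>

lemma chain_count_rect_compl_rev:
  assumes "\<mu> \<in> partitions_in_rect k l" "\<Lambda> \<in> partitions_in_rect k l"
  shows "chain_count (rev bs) (rect_compl k l \<Lambda>) (rect_compl k l \<mu>) = chain_count bs \<mu> \<Lambda>"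
  using assms
proof (induction bs arbitrary: \<mu>)
  case Nil
  then have "rect_compl k l \<Lambda> = rect_compl k l \<mu> \<longleftrightarrow> \<mu> = \<Lambda>"
    by (metis rect_compl_rect_compl)
  then show ?case by (simp add: chain_count_Nil)
next
  case (Cons b bs)
  let ?c = "rect_compl k l" and ?P = "partitions_in_rect k l"
  have "chain_count (rev (b # bs)) (?c \<Lambda>) (?c \<mu>) =
    (\<Sum>\<kappa>\<in>?P. chain_count (rev bs) (?c \<Lambda>) \<kappa> * strip_count b \<kappa> (?c \<mu>))"
    using Cons.prems by (simp add: chain_count_append chain_count_single rect_compl_in_rect)
  also have "\<dots> = (\<Sum>\<beta>\<in>?P. chain_count (rev bs) (?c \<Lambda>) (?c \<beta>) * strip_count b (?c \<beta>) (?c \<mu>))"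
    by (rule sum.reindex_bij_betw[OF bij_betw_rect_compl, symmetric])
  also have "\<dots> = chain_count (b # bs) \<mu> \<Lambda>"
    using Cons by (simp add: chain_count_Cons strip_count_rect_compl mult.commute)
  finally show ?case .
qed


section \<open>Alternating sums of numbers of chains\<close>

text \<open>Up to the indexing from \<open>0\<close>, this is \<open>w(\<nu> + \<rho>) - \<rho>\<close>.\<close>

definition dot_action :: "ptn \<Rightarrow> (nat \<Rightarrow> nat) \<Rightarrow> nat \<Rightarrow> int" where
  "dot_action \<nu> w i = int (\<nu> (w i)) - int (w i) + int i"

text \<open>The Jacobi-Trudi determinant of \<open>\<nu>\<close> in the commuting matrices \<open>strip_count b\<close>.\<close>

definition jacobi_trudi :: "ptn \<Rightarrow> ptn \<Rightarrow> ptn \<Rightarrow> int" where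
  "jacobi_trudi \<nu> \<mu> \<Lambda> = (\<Sum>w | w permutes {..<l}.
     sign w * chain_count (map (dot_action \<nu> w) [0..<l]) \<mu> \<Lambda>)"

text \<open>Both determinants are integer polynomials in the same commuting matrices.\<close>

lemma jacobi_trudi_commute:
  assumes "l > 0" "\<alpha> \<in> partitions_in_rect k l"
  shows "(\<Sum>\<kappa>\<in>partitions_in_rect k l. jacobi_trudi \<mu> \<alpha> \<kappa> * jacobi_trudi \<nu> \<kappa> \<Lambda>) =
    (\<Sum>\<kappa>\<in>partitions_in_rect k l. jacobi_trudi \<nu> \<alpha> \<kappa> * jacobi_trudi \<mu> \<kappa> \<Lambda>)"
proof -
  let ?W = "{w. w permutes {..<l}}" and ?P = "partitions_in_rect k l"
  have expand: "(\<Sum>\<kappa>\<in>?P. jacobi_trudi \<mu> \<alpha> \<kappa> * jacobi_trudi \<nu> \<kappa> \<Lambda>) = (\<Sum>w\<in>?W. \<Sum>v\<in>?W.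
    sign w * sign v * chain_count (map (dot_action \<mu> w) [0..<l] @ map (dot_action \<nu> v) [0..<l]) \<alpha> \<Lambda>)"
    for \<mu> \<nu>
  proof -
    have "(\<Sum>\<kappa>\<in>?P. jacobi_trudi \<mu> \<alpha> \<kappa> * jacobi_trudi \<nu> \<kappa> \<Lambda>) = (\<Sum>\<kappa>\<in>?P. \<Sum>w\<in>?W. \<Sum>v\<in>?W.
      sign w * sign v * (chain_count (map (dot_action \<mu> w) [0..<l]) \<alpha> \<kappa> *
        chain_count (map (dot_action \<nu> v) [0..<l]) \<kappa> \<Lambda>))"
      by (simp add: jacobi_trudi_def sum_product mult_ac)
    also have "\<dots> = (\<Sum>w\<in>?W. \<Sum>v\<in>?W. \<Sum>\<kappa>\<in>?P.
      sign w * sign v * (chain_count (map (dot_action \<mu> w) [0..<l]) \<alpha> \<kappa> *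
        chain_count (map (dot_action \<nu> v) [0..<l]) \<kappa> \<Lambda>))"
      by (rule trans[OF sum.swap], rule sum.cong[OF refl], rule sum.swap)
    finally show ?thesis
      by (simp add: chain_count_append assms(2) sum_distrib_left)
  qed
  \<comment> \<open>Once the two sums over permutations are swapped, corresponding terms differ only
    in the order in which the two lists of strip sizes are appended.\<close>
  show ?thesis
    unfolding expand
    by (subst sum.swap, intro sum.cong refl, subst chain_count_mset[OF assms(1)])
      (auto simp: union_commute mult_ac)
qed

text \<open>Transposition reverses each product in the determinant, and commutativity restores the
  order.\<close>

lemma jacobi_trudi_rect_compl:
  assumes "l > 0" "\<mu> \<in> partitions_in_rect k l" "\<Lambda> \<in> partitions_in_rect k l"
  shows "jacobi_trudi \<nu> (rect_compl k l \<Lambda>) (rect_compl k l \<mu>) = jacobi_trudi \<nu> \<mu> \<Lambda>"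
  unfolding jacobi_trudi_def
proof (intro sum.cong refl arg_cong2[of _ _ _ _ "(*)"])
  fix w
  show "chain_count (map (dot_action \<nu> w) [0..<l]) (rect_compl k l \<Lambda>) (rect_compl k l \<mu>) =
    chain_count (map (dot_action \<nu> w) [0..<l]) \<mu> \<Lambda>"
    using chain_count_rect_compl_rev[OF assms(2,3)]
      chain_count_mset[OF assms(1), of "rev (map (dot_action \<nu> w) [0..<l])"]
    by (metis mset_rev)
qed

end


section \<open>Chains of horizontal strips and the lattice condition\<close>

text \<open>A finite chain is extended constantly by \<open>\<Lambda>\<close> from \<open>n\<close>
  on, so that each chain is a single total function and sets of chains can be counted.\<close>

definition strip_chains :: "nat \<Rightarrow> nat \<Rightarrow> nat \<Rightarrow> (nat \<Rightarrow> int) \<Rightarrow> ptn \<Rightarrow> ptn \<Rightarrow> (nat \<Rightarrow> ptn) set" where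
  "strip_chains k l n b \<mu> \<Lambda> = {c. c 0 = \<mu> \<and> (\<forall>i\<ge>n. c i = \<Lambda>) \<and> (\<forall>i. c i \<in> partitions_in_rect k l) \<and>
     (\<forall>i. horizontal_strip (c i) (c (Suc i))) \<and>
     (\<forall>i<n. ptn_size l (c (Suc i)) - ptn_size l (c i) = b i)}"

lemma strip_chains_0:
  assumes "\<Lambda> \<in> partitions_in_rect k l"
  shows "strip_chains k l 0 b \<mu> \<Lambda> = (if \<mu> = \<Lambda> then {\<lambda>_. \<Lambda>} else {})"
proof -
  have "horizontal_strip \<Lambda> \<Lambda>"
    using assms by (intro horizontal_strip_refl) (auto simp: partitions_in_rect_iff)
  then show ?thesis using assms by (auto simp: strip_chains_def fun_eq_iff)
qed

lemma strip_chains_Suc: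
  assumes "\<mu> \<in> partitions_in_rect k l"
  shows "strip_chains k l (Suc n) b \<mu> \<Lambda> =
    (\<Union>\<beta>\<in>{\<beta> \<in> partitions_in_rect k l. strip_count k l (b 0) \<mu> \<beta> = 1}.
      case_nat \<mu> ` strip_chains k l n (b \<circ> Suc) \<beta> \<Lambda>)" (is "_ = ?R")
proof (intro equalityI subsetI)
  fix c assume c: "c \<in> strip_chains k l (Suc n) b \<mu> \<Lambda>"
  then have "c = case_nat \<mu> (c \<circ> Suc)"
    by (auto simp: strip_chains_def fun_eq_iff split: nat.split)
  moreover have "c \<circ> Suc \<in> strip_chains k l n (b \<circ> Suc) (c 1) \<Lambda>"
    using c by (auto simp: strip_chains_def)
  moreover have "c 1 \<in> partitions_in_rect k l" "strip_count k l (b 0) \<mu> (c 1) = 1"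
    using c assms by (auto simp: strip_chains_def strip_count_def)
  ultimately show "c \<in> ?R" by blast
next
  fix c assume "c \<in> ?R"
  then obtain \<beta> d where b: "\<beta> \<in> partitions_in_rect k l" "strip_count k l (b 0) \<mu> \<beta> = 1"
    and d: "d \<in> strip_chains k l n (b \<circ> Suc) \<beta> \<Lambda>" and c: "c = case_nat \<mu> d" by blast
  have b': "horizontal_strip \<mu> \<beta>" "ptn_size l \<beta> - ptn_size l \<mu> = b 0"
    using b(2) by (auto simp: strip_count_def of_bool_def split: if_splits)
  show "c \<in> strip_chains k l (Suc n) b \<mu> \<Lambda>"
    using b b' d assms unfolding strip_chains_def c
    by (auto split: nat.split simp: less_Suc_eq_0_disj Suc_le_eq)
qed

text \<open>Finiteness is carried through the induction because the cardinality of the disjoint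
  union over the first step depends on it.\<close>

lemma chain_count_eq_card_aux:
  assumes "\<mu> \<in> partitions_in_rect k l" "\<Lambda> \<in> partitions_in_rect k l"
  shows "finite (strip_chains k l n b \<mu> \<Lambda>) \<and>
    chain_count k l (map b [0..<n]) \<mu> \<Lambda> = int (card (strip_chains k l n b \<mu> \<Lambda>))"
  using assms(1)
proof (induction n arbitrary: b \<mu>)
  case 0
  then show ?case by (auto simp: strip_chains_0 assms(2) chain_count_Nil)
next
  case (Suc n)
  let ?B = "{\<beta> \<in> partitions_in_rect k l. strip_count k l (b 0) \<mu> \<beta> = 1}"
  have IH: "finite (strip_chains k l n (b \<circ> Suc) \<beta> \<Lambda>)"
    "chain_count k l (map (b \<circ> Suc) [0..<n]) \<beta> \<Lambda> = int (card (strip_chains k l n (b \<circ> Suc) \<beta> \<Lambda>))"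
    if "\<beta> \<in> partitions_in_rect k l" for \<beta>
    using Suc.IH[OF that, of "b \<circ> Suc"] by blast+
  have fin: "finite ?B" using finite_partitions_in_rect by simp
  have inj: "inj (case_nat \<mu> :: (nat \<Rightarrow> ptn) \<Rightarrow> _)"
  proof (rule injI)
    fix c d :: "nat \<Rightarrow> ptn" assume *: "case_nat \<mu> c = case_nat \<mu> d"
    show "c = d"
    proof
      fix x show "c x = d x" using fun_cong[OF *, of "Suc x"] by simp
    qed
  qed
  have disj: "case_nat \<mu> ` strip_chains k l n (b \<circ> Suc) \<beta> \<Lambda> \<inter> case_nat \<mu> ` strip_chains k l n (b \<circ> Suc) \<beta>' \<Lambda> = {}"
    if "\<beta> \<noteq> \<beta>'" for \<beta> \<beta>'
  proof -
    have "d 0 = \<beta>" if "d \<in> strip_chains k l n (b \<circ> Suc) \<beta> \<Lambda>" for \<beta> d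
      using that by (simp add: strip_chains_def)
    then show ?thesis using that injD[OF inj] by blast
  qed
  have map: "map b [0..<Suc n] = b 0 # map (b \<circ> Suc) [0..<n]"
    by (simp add: upt_conv_Cons map_Suc_upt[symmetric] del: upt_Suc)
  have "chain_count k l (map b [0..<Suc n]) \<mu> \<Lambda> = (\<Sum>\<beta>\<in>partitions_in_rect k l.
      if \<beta> \<in> ?B then int (card (strip_chains k l n (b \<circ> Suc) \<beta> \<Lambda>)) else 0)"
    unfolding map chain_count_Cons
    by (intro sum.cong) (auto simp: IH, auto simp: strip_count_def of_bool_def split: if_splits)
  also have "\<dots> = (\<Sum>\<beta>\<in>?B. int (card (strip_chains k l n (b \<circ> Suc) \<beta> \<Lambda>)))"
    by (subst sum.inter_restrict[symmetric, OF finite_partitions_in_rect])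
      (intro sum.cong, auto)
  also have "\<dots> = (\<Sum>\<beta>\<in>?B. int (card (case_nat \<mu> ` strip_chains k l n (b \<circ> Suc) \<beta> \<Lambda>)))"
    using card_image[OF inj_on_subset[OF inj subset_UNIV]] by simp
  also have "\<dots> = int (card (strip_chains k l (Suc n) b \<mu> \<Lambda>))"
    unfolding strip_chains_Suc[OF Suc.prems]
    using fin IH(1) disj by (subst card_UN_disjoint) auto
  finally have "chain_count k l (map b [0..<Suc n]) \<mu> \<Lambda> = int (card (strip_chains k l (Suc n) b \<mu> \<Lambda>))" .
  moreover have "finite (strip_chains k l (Suc n) b \<mu> \<Lambda>)"
    unfolding strip_chains_Suc[OF Suc.prems] using fin IH(1) by auto
  ultimately show ?case by blast
qed

lemma finite_strip_chains:
  "\<mu> \<in> partitions_in_rect k l \<Longrightarrow> \<Lambda> \<in> partitions_in_rect k l \<Longrightarrow> finite (strip_chains k l n b \<mu> \<Lambda>)"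
  using chain_count_eq_card_aux by blast

lemma chain_count_eq_card:
  "\<mu> \<in> partitions_in_rect k l \<Longrightarrow> \<Lambda> \<in> partitions_in_rect k l \<Longrightarrow>
    chain_count k l (map b [0..<n]) \<mu> \<Lambda> = int (card (strip_chains k l n b \<mu> \<Lambda>))"
  using chain_count_eq_card_aux by blast

text \<open>Placing \<open>i + 1\<close> in the boxes of \<open>c (i + 1)\<close> outside \<open>c i\<close> gives a tableau. In its reverse
  row word, somewhere within row \<open>r\<close> the letters \<open>i + 2\<close> outnumber the letters \<open>i + 1\<close>.\<close>

definition violation :: "(nat \<Rightarrow> ptn) \<Rightarrow> nat \<Rightarrow> nat \<Rightarrow> bool" where
  "violation c r i \<longleftrightarrow> (\<Sum>j<r. int (c (Suc i) j) - int (c i j)) <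
     (\<Sum>j\<le>r. int (c (Suc (Suc i)) j) - int (c (Suc i) j))"

definition good :: "(nat \<Rightarrow> ptn) \<Rightarrow> bool" where
  "good c \<longleftrightarrow> (\<forall>r i. \<not> violation c r i)"

text \<open>Rows are read from the top, and within a row larger letters come first. So the earliest
  violation in the reverse row word lies in the topmost violated row and, within it, belongs to the
  greatest violated index.\<close>

definition first_row :: "(nat \<Rightarrow> ptn) \<Rightarrow> nat" where
  "first_row c = (LEAST r. \<exists>i. violation c r i)"

definition last_letter :: "(nat \<Rightarrow> ptn) \<Rightarrow> nat" where
  "last_letter c = (GREATEST i. violation c (first_row c) i)"

text \<open>The first \<open>surplus\<close> letters \<open>i + 2\<close> in row \<open>r\<close> are harmless; the next one is the first to
  violate the lattice condition, and the reflection is applied to the part of the tableau after it.\<close>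

definition surplus :: "(nat \<Rightarrow> ptn) \<Rightarrow> nat \<Rightarrow> nat \<Rightarrow> int" where
  "surplus c r i = (\<Sum>j<r. (int (c (Suc i) j) - int (c i j)) - (int (c (Suc (Suc i)) j) - int (c (Suc i) j)))"

text \<open>Row \<open>r\<close> is reflected only to the left of the violating letter, whose column
  is the upper end passed to \<open>flip\<close>; hence the subtracted \<open>1\<close>. The rows
  above have been read before it and stay fixed.\<close>

definition switch_at :: "nat \<Rightarrow> nat \<Rightarrow> (nat \<Rightarrow> ptn) \<Rightarrow> nat \<Rightarrow> ptn" where
  "switch_at r i c = c (Suc i := flip r (nat (int (c (Suc (Suc i)) r) - surplus c r i - 1))
     (c i) (c (Suc (Suc i))) (c (Suc i)))"

definition switch :: "(nat \<Rightarrow> ptn) \<Rightarrow> nat \<Rightarrow> ptn" where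
  "switch c = switch_at (first_row c) (last_letter c) c"

lemma violation_iff_surplus:
  "violation c r i \<longleftrightarrow> surplus c r i < int (c (Suc (Suc i)) r) - int (c (Suc i) r)"
  unfolding violation_def surplus_def lessThan_Suc_atMost[symmetric] sum.lessThan_Suc sum_subtractf
  by linarith

section \<open>Switching a bad chain after its first violation\<close>

locale bad_chain =
  fixes k l n :: nat and b :: "nat \<Rightarrow> int" and \<mu> \<Lambda> :: ptn and c :: "nat \<Rightarrow> ptn"
  assumes chain: "c \<in> strip_chains k l n b \<mu> \<Lambda>" and bad: "\<not> good c"
begin

definition "r = first_row c"
definition "i = last_letter c"
definition "u = nat (int (c (Suc (Suc i)) r) - surplus c r i - 1)"

lemma switch_eq: "switch c = c (Suc i := flip r u (c i) (c (Suc (Suc i))) (c (Suc i)))"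
  by (simp add: switch_def switch_at_def r_def i_def u_def)

lemma strip: "horizontal_strip (c j) (c (Suc j))"
  using chain by (auto simp: strip_chains_def)

lemma in_rect: "c j \<in> partitions_in_rect k l"
  using chain by (auto simp: strip_chains_def)

text \<open>From index \<open>n\<close> on the chain is constant, so no letters are left that could
  cause a violation. This bound makes the greatest violated index exist.\<close>

lemma violation_less:
  assumes "violation c s j"
  shows "Suc j < n"
proof (rule ccontr)
  assume "\<not> Suc j < n"
  then have "c (Suc (Suc j)) = c (Suc j)" using chain by (auto simp: strip_chains_def)
  moreover have "(\<Sum>m<s. int (c (Suc j) m) - int (c j m)) \<ge> 0"
    using horizontal_stripD(1)[OF strip] by (intro sum_nonneg) simp
  ultimately show False using assms by (simp add: violation_def)
qed

lemma violation: "violation c r i"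
  and no_violation_above: "s < r \<Longrightarrow> \<not> violation c s j"
  and no_violation_larger: "i < j \<Longrightarrow> \<not> violation c r j"
proof -
  have "\<exists>r i. violation c r i" using bad by (auto simp: good_def)
  then have ex: "\<exists>i. violation c r i"
    unfolding r_def first_row_def by (rule LeastI_ex)
  show "\<not> violation c s j" if "s < r"
    using that not_less_Least unfolding r_def first_row_def by blast
  have bound: "\<forall>j. violation c r j \<longrightarrow> j \<le> n"
    using violation_less by fastforce
  show "violation c r i"
    unfolding i_def last_letter_def r_def[symmetric]
    by (rule GreatestI_ex_nat[OF ex]) (use bound in blast)
  show "\<not> violation c r j" if "i < j"
  proof
    assume "violation c r j"
    then have "j \<le> i" unfolding i_def last_letter_def r_def[symmetric]
      by (rule Greatest_le_nat) (use bound in blast)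
    with that show False by simp
  qed
qed

text \<open>Row \<open>r - 1\<close> has no violation, so after it the surplus is at least the
  number of letters \<open>i + 1\<close> in that row. The strip condition between rows
  \<open>r - 1\<close> and \<open>r\<close> then gives the second bound, which \<open>u\<close> has
  to satisfy.\<close>

lemma surplus_bounds:
  "surplus c r i \<ge> 0"
  "r > 0 \<Longrightarrow> int (c (Suc (Suc i)) r) - surplus c r i \<le> int (c i (r - 1))"
proof -
  have *: "surplus c (Suc s) i \<ge> int (c (Suc i) s) - int (c i s)" if "r = Suc s" for s
    using no_violation_above[of s i] that by (simp add: violation_iff_surplus) (simp add: surplus_def)
  show "surplus c r i \<ge> 0"
  proof (cases r)
    case 0
    then show ?thesis by (simp add: surplus_def)
  next
    case (Suc s)
    then show ?thesis using *[OF Suc] horizontal_stripD(1)[OF strip, of i s] by simp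
  qed
  show "int (c (Suc (Suc i)) r) - surplus c r i \<le> int (c i (r - 1))" if pos: "r > 0"
  proof -
    obtain s where s: "r = Suc s" using pos by (cases r) auto
    show ?thesis
      using *[OF s] horizontal_stripD(2)[OF strip, of "Suc i" s] by (simp add: s)
  qed
qed

lemma u_eq: "int u = int (c (Suc (Suc i)) r) - surplus c r i - 1"
  using violation by (simp add: violation_iff_surplus u_def)

sublocale flippable r u "c i" "c (Suc (Suc i))" "c (Suc i)"
proof
  show "horizontal_strip (c i) (c (Suc i))" "horizontal_strip (c (Suc i)) (c (Suc (Suc i)))"
    by (rule strip)+
  show "c (Suc i) r \<le> u"
    using violation u_eq by (simp add: violation_iff_surplus)
  show "u \<le> c (Suc (Suc i)) r" using surplus_bounds(1) u_eq by simp
  show "r = 0 \<or> u \<le> c i (r - 1)" using surplus_bounds(2) u_eq by fastforce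
qed

lemma switch_same_rows: "s < r \<Longrightarrow> switch c j s = c j s"
  by (simp add: switch_eq flip_def)

lemma switch_other: "j \<noteq> Suc i \<Longrightarrow> switch c j = c j"
  by (simp add: switch_eq)

lemma surplus_switch: "s \<le> r \<Longrightarrow> surplus (switch c) s j = surplus c s j"
  unfolding surplus_def by (intro sum.cong) (auto simp: switch_same_rows)

text \<open>The violating letter survives because the reflected part of row \<open>r\<close> is at
  most \<open>u\<close>. For \<open>j > i\<close>, a violation in row \<open>r\<close> involves
  \<open>c (Suc i)\<close> only in rows above \<open>r\<close>, where nothing changes.\<close>

lemma switch_violation:
  "violation (switch c) r i"
  "s < r \<Longrightarrow> \<not> violation (switch c) s j"
  "i < j \<Longrightarrow> \<not> violation (switch c) r j"
proof -
  have "flip r u (c i) (c (Suc (Suc i))) (c (Suc i)) r \<le> u"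
    using flip_bounds(2)[of r] by simp
  then show "violation (switch c) r i"
    using u_eq by (simp add: violation_iff_surplus surplus_switch) (simp add: switch_eq)
  show "\<not> violation (switch c) s j" if "s < r"
    using that no_violation_above[OF that, of j]
    by (simp add: violation_iff_surplus surplus_switch switch_same_rows)
  show "\<not> violation (switch c) r j" if "i < j"
    using that no_violation_larger[OF that]
    by (simp add: violation_iff_surplus surplus_switch switch_other)
qed

lemma switch_bad: "\<not> good (switch c)"
  using switch_violation(1) by (auto simp: good_def)

lemma first_row_switch: "first_row (switch c) = r"
  unfolding first_row_def using switch_violation(1,2)
  by (intro Least_equality) (blast, meson not_less)

lemma last_letter_switch: "last_letter (switch c) = i"
  unfolding last_letter_def first_row_switch using switch_violation(1,3)
  by (intro Greatest_equality) (blast, meson not_less)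

text \<open>The switched chain has the same first row, last letter and surplus, so the second switch
  uses the same \<open>u\<close> and \<open>flip_flip\<close> applies.\<close>

lemma switch_switch: "switch (switch c) = c"
proof -
  have "switch (switch c) = switch_at r i (switch c)"
    unfolding switch_def[of "switch c"] first_row_switch last_letter_switch ..
  also have "\<dots> = c"
    unfolding switch_at_def surplus_switch[OF order_refl]
    using flip_flip by (simp add: switch_eq u_def)
  finally show ?thesis .
qed

lemma Suc_i_less: "Suc i < n"
  using violation_less violation by blast

text \<open>In \<open>ptn_size_flip\<close> the rows above \<open>r\<close> contribute the surplus,
  and \<open>u\<close> contributes its negative minus \<open>1\<close>.\<close>

lemma ptn_size_switch:
  "ptn_size l (switch c (Suc i)) = ptn_size l (c i) + ptn_size l (c (Suc (Suc i))) - ptn_size l (c (Suc i)) - 1"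
proof -
  \<comment> \<open>A violation requires a letter \<open>i + 2\<close> in row \<open>r\<close>, so
    this row meets the rectangle.\<close>
  have "0 < c (Suc (Suc i)) r"
    using violation surplus_bounds(1) by (simp add: violation_iff_surplus)
  then have "r < l" using in_rect[of "Suc (Suc i)"] by (metis partitions_in_rect_iff not_less less_irrefl)
  moreover have "c (Suc (Suc i)) l = 0" using in_rect by (auto simp: partitions_in_rect_iff)
  moreover have "(\<Sum>j<r. 2 * int (c (Suc i) j) - int (c i j) - int (c (Suc (Suc i)) j)) = surplus c r i"
    unfolding surplus_def by (intro sum.cong) auto
  ultimately show ?thesis
    using ptn_size_flip[of l] u_eq by (simp add: switch_eq)
qed

text \<open>The new strip sizes are those that \<open>dot_action\<close> produces when
  \<open>w\<close> is composed with the transposition of \<open>i\<close> and \<open>Suc i\<close>;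
  the shifts by \<open>1\<close> come from the term \<open>int i\<close> in
  \<open>dot_action\<close>.\<close>

lemma switch_chain:
  "switch c \<in> strip_chains k l n (b(i := b (Suc i) - 1, Suc i := b i + 1)) \<mu> \<Lambda>"
proof -
  have size: "ptn_size l (c (Suc j)) - ptn_size l (c j) = b j" if "j < n" for j
    using chain that by (auto simp: strip_chains_def)
  have "switch c 0 = \<mu>" "\<forall>j\<ge>n. switch c j = \<Lambda>"
    using chain Suc_i_less by (auto simp: strip_chains_def switch_eq)
  moreover have "switch c j \<in> partitions_in_rect k l" for j
    using in_rect flip_in_rect[OF in_rect] by (simp add: switch_eq)
  moreover have "horizontal_strip (switch c j) (switch c (Suc j))" for j
    using strip flip_strips by (simp add: switch_eq)
  moreover have "ptn_size l (switch c (Suc j)) - ptn_size l (switch c j) =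
    (b(i := b (Suc i) - 1, Suc i := b i + 1)) j" if "j < n" for j
  proof -
    consider "j = i" | "j = Suc i" | "j \<noteq> i" "j \<noteq> Suc i" by blast
    then show ?thesis
    proof cases
      case 1
      then show ?thesis using size[of "Suc i"] Suc_i_less ptn_size_switch by (simp add: switch_other)
    next
      case 2
      then show ?thesis using size[of i] Suc_i_less ptn_size_switch by (simp add: switch_other)
    next
      case 3
      then show ?thesis using size[OF that] by (simp add: switch_other)
    qed
  qed
  ultimately show ?thesis by (simp add: strip_chains_def)
qed

end

section \<open>Cancellation of the bad chains\<close>

lemma strip_chains_cong: "(\<And>i. i < n \<Longrightarrow> b i = b' i) \<Longrightarrow> strip_chains k l n b \<mu> \<Lambda> = strip_chains k l n b' \<mu> \<Lambda>"
  by (simp add: strip_chains_def)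

text \<open>A good chain has weakly decreasing strip sizes, whereas
  \<open>dot_action \<nu> w\<close> increases strictly at each descent of \<open>w\<close>. So
  \<open>w\<close> has no descents.\<close>

lemma good_chain_perm_eq_id:
  assumes w: "w permutes {..<l}" and \<nu>: "antimono \<nu>"
    and c: "c \<in> strip_chains k l l (dot_action \<nu> w) \<mu> \<Lambda>" and good: "good c"
  shows "w = id"
proof -
  have in_rect: "c j \<in> partitions_in_rect k l" for j
    using c by (auto simp: strip_chains_def)
  have "w i < w (Suc i)" if "Suc i < l" for i
  proof (rule ccontr)
    assume "\<not> ?thesis"
    moreover have "w i \<noteq> w (Suc i)" using permutes_inj[OF w] by (metis injD n_not_Suc_n)
    ultimately have less: "w (Suc i) < w i" by simp
    then have "\<nu> (w i) \<le> \<nu> (w (Suc i))" using \<nu> by (auto simp: antimono_def)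
    then have "dot_action \<nu> w i < dot_action \<nu> w (Suc i)"
      using less by (simp add: dot_action_def)
    \<comment> \<open>Row \<open>l\<close> is empty, so there the criterion compares the total
      numbers of the two letters.\<close>
    moreover have "\<not> violation c l i" using good by (simp add: good_def)
    then have "ptn_size l (c (Suc (Suc i))) - ptn_size l (c (Suc i)) \<le> ptn_size l (c (Suc i)) - ptn_size l (c i)"
      using in_rect by (simp add: violation_def lessThan_Suc_atMost[symmetric] ptn_size_def
        sum_subtractf partitions_in_rect_iff)
    moreover have "ptn_size l (c (Suc j)) - ptn_size l (c j) = dot_action \<nu> w j" if "j < l" for j
      using c that by (simp add: strip_chains_def)
    ultimately show False using that by (metis Suc_lessD not_less)
  qed
  then have "i \<le> w i" if "i < l" for i
    using that by (induction i) (auto, meson Suc_leI Suc_lessD le_less_trans)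
  then show "w = id" using permutes_natset_ge[OF w] by auto
qed

text \<open>On pairs of a permutation and a bad chain, switching the chain and composing the
  permutation with the adjacent transposition is an involution that reverses signs.\<close>

lemma sum_sign_bad_chains:
  assumes "\<mu> \<in> partitions_in_rect k l" "\<Lambda> \<in> partitions_in_rect k l"
  shows "(\<Sum>w | w permutes {..<l}. sign w *
    int (card {c \<in> strip_chains k l l (dot_action \<nu> w) \<mu> \<Lambda>. \<not> good c})) = 0"
proof -
  let ?W = "{w. w permutes {..<l}}"
  define B where "B w = {c \<in> strip_chains k l l (dot_action \<nu> w) \<mu> \<Lambda>. \<not> good c}" for w
  define f where "f = (\<lambda>(w :: nat \<Rightarrow> nat, c). (w \<circ> Transposition.transpose (last_letter c) (Suc (last_letter c)), switch c))"
  have fin: "finite ?W" "finite (B w)" for w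
    using finite_permutations[of "{..<l}"] finite_strip_chains[OF assms] by (auto simp: B_def)
  have f: "f x \<in> Sigma ?W B \<and> f (f x) = x \<and> (sign (fst (f x)) :: int) = - sign (fst x)"
    if in_B: "x \<in> Sigma ?W B" for x
  proof -
    obtain w c where x: "x = (w, c)" "w permutes {..<l}" "c \<in> strip_chains k l l (dot_action \<nu> w) \<mu> \<Lambda>" "\<not> good c"
      using in_B by (cases x) (auto simp: B_def)
    interpret bad_chain k l l "dot_action \<nu> w" \<mu> \<Lambda> c
      using x by unfold_locales
    let ?t = "Transposition.transpose i (Suc i)"
    have fx: "f x = (w \<circ> ?t, switch c)" by (simp add: f_def x i_def)
    have t: "?t permutes {..<l}"
      using Suc_i_less by (intro permutes_swap_id) auto
    have "strip_chains k l l ((dot_action \<nu> w)(i := dot_action \<nu> w (Suc i) - 1, Suc i := dot_action \<nu> w i + 1)) \<mu> \<Lambda>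
      = strip_chains k l l (dot_action \<nu> (w \<circ> ?t)) \<mu> \<Lambda>"
      by (intro strip_chains_cong) (auto simp: dot_action_def Transposition.transpose_def)
    then have "f x \<in> Sigma ?W B"
      using switch_chain switch_bad permutes_compose[OF t x(2)] by (simp add: fx B_def)
    moreover have "f (f x) = (w \<circ> ?t \<circ> ?t, c)"
      unfolding fx by (simp add: f_def last_letter_switch switch_switch)
    then have "f (f x) = x" by (simp add: x(1) comp_assoc)
    moreover have "permutation w" using x(2) permutation_permutes by blast
    then have "(sign (w \<circ> ?t) :: int) = - sign w"
      by (simp add: sign_compose permutation_swap_id sign_swap_id)
    then have "(sign (fst (f x)) :: int) = - sign (fst x)" unfolding fx by (simp add: x(1))
    ultimately show ?thesis by blast
  qed
  have "(\<Sum>x\<in>Sigma ?W B. sign (fst x) :: int) = (\<Sum>x\<in>Sigma ?W B. sign (fst (f x)))"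
    by (rule sum.reindex_bij_witness[where i = f and j = f]) (use f in auto)
  also have "\<dots> = - (\<Sum>x\<in>Sigma ?W B. sign (fst x))"
    using f by (simp add: sum_negf[symmetric])
  finally have "(\<Sum>x\<in>Sigma ?W B. sign (fst x) :: int) = 0" by simp
  moreover have "(\<Sum>x\<in>Sigma ?W B. sign (fst x) :: int) = (\<Sum>w\<in>?W. \<Sum>c\<in>B w. sign w)"
    using fin by (subst sum.Sigma) (auto simp: case_prod_beta)
  ultimately show ?thesis by (simp add: B_def mult.commute)
qed

text \<open>Bad chains cancel, and good chains occur only for the identity permutation, where
  \<open>dot_action\<close> gives the parts of \<open>\<nu>\<close>.\<close>

lemma jacobi_trudi_eq_card:
  assumes "\<mu> \<in> partitions_in_rect k l" "\<Lambda> \<in> partitions_in_rect k l" "\<nu> \<in> partitions_in_rect k l"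
  shows "jacobi_trudi k l \<nu> \<mu> \<Lambda> = int (card {c \<in> strip_chains k l l (\<lambda>i. int (\<nu> i)) \<mu> \<Lambda>. good c})"
proof -
  let ?W = "{w. w permutes {..<l}}"
  define C where "C w = strip_chains k l l (dot_action \<nu> w) \<mu> \<Lambda>" for w
  have "int (card (C w)) = int (card {c \<in> C w. good c}) + int (card {c \<in> C w. \<not> good c})" for w
  proof -
    have "card (C w) = card ({c \<in> C w. good c} \<union> {c \<in> C w. \<not> good c})"
      by (rule arg_cong[where f = card]) blast
    also have "\<dots> = card {c \<in> C w. good c} + card {c \<in> C w. \<not> good c}"
      by (rule card_Un_disjoint) (auto simp: C_def finite_strip_chains[OF assms(1,2)])
    finally show ?thesis by simp
  qed
  then have "jacobi_trudi k l \<nu> \<mu> \<Lambda> = (\<Sum>w\<in>?W. sign w * int (card {c \<in> C w. good c}))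
      + (\<Sum>w\<in>?W. sign w * int (card {c \<in> C w. \<not> good c}))"
    using assms by (simp add: jacobi_trudi_def chain_count_eq_card C_def algebra_simps sum.distrib)
  also have "(\<Sum>w\<in>?W. sign w * int (card {c \<in> C w. \<not> good c})) = 0"
    using sum_sign_bad_chains[OF assms(1,2)] by (simp add: C_def)
  also have "(\<Sum>w\<in>?W. sign w * int (card {c \<in> C w. good c})) =
      (\<Sum>w\<in>?W. if w = id then int (card {c \<in> C id. good c}) else 0)"
  proof (intro sum.cong refl)
    fix w assume w: "w \<in> ?W"
    have empty: "{c \<in> C w. good c} = {}" if "w \<noteq> id"
      using good_chain_perm_eq_id[of w l \<nu>] w that assms(3) unfolding C_def partitions_in_rect_iff by blast
    have "card {c \<in> C w. good c} = 0" if ne: "w \<noteq> id" by (simp only: empty[OF ne] card.empty)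
    then show "sign w * int (card {c \<in> C w. good c}) = (if w = id then int (card {c \<in> C id. good c}) else 0)"
      by (auto simp: sign_id)
  qed
  also have "\<dots> = int (card {c \<in> C id. good c})"
    using finite_permutations[of "{..<l}"] by (simp add: permutes_id)
  also have "C id = strip_chains k l l (\<lambda>i. int (\<nu> i)) \<mu> \<Lambda>"
    unfolding C_def by (intro strip_chains_cong) (simp add: dot_action_def)
  finally show ?thesis by simp
qed


section \<open>Littlewood-Richardson tableaux as chains\<close>

lemma skew_diagram_iff: "(r, j) \<in> skew_diagram \<Lambda> \<mu> \<longleftrightarrow> \<mu> r \<le> j \<and> j < \<Lambda> r"
  by (auto simp: skew_diagram_def diagram_def)

lemma int_card_between:
  assumes "\<And>r. \<alpha> r \<le> \<beta> r" "\<And>r. r \<ge> l \<Longrightarrow> \<beta> r = 0"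
  shows "int (card {(r, j). \<alpha> r \<le> j \<and> j < \<beta> r}) = ptn_size l \<beta> - ptn_size l \<alpha>"
proof -
  have "{(r, j). \<alpha> r \<le> j \<and> j < \<beta> r} = Sigma {..<l} (\<lambda>r. {\<alpha> r..<\<beta> r})"
    using assms(2) by (auto simp: not_less) (metis not_less_zero not_less)
  then show ?thesis
    using assms(1) by (simp add: ptn_size_def of_nat_diff sum_subtractf)
qed

lemma int_card_skew_diagram:
  assumes "diagram \<mu> \<subseteq> diagram \<Lambda>" "\<Lambda> \<in> partitions_in_rect k l"
  shows "int (card (skew_diagram \<Lambda> \<mu>)) = ptn_size l \<Lambda> - ptn_size l \<mu>"
proof -
  have "skew_diagram \<Lambda> \<mu> = {(r, j). \<mu> r \<le> j \<and> j < \<Lambda> r}"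
    by (auto simp: skew_diagram_iff)
  then show ?thesis
    using int_card_between[of \<mu> \<Lambda> l] assms by (auto simp: diagram_subset_iff partitions_in_rect_iff)
qed

lemma finite_skew_diagram:
  assumes "\<Lambda> \<in> partitions_in_rect k l"
  shows "finite (skew_diagram \<Lambda> \<mu>)"
proof (rule finite_subset)
  show "skew_diagram \<Lambda> \<mu> \<subseteq> {..<l} \<times> {..<k}"
  proof clarify
    fix r j assume "(r, j) \<in> skew_diagram \<Lambda> \<mu>"
    then have "j < \<Lambda> r" by (simp add: skew_diagram_iff)
    moreover have "\<Lambda> r \<le> k" "l \<le> r \<Longrightarrow> \<Lambda> r = 0" using assms by (auto simp: partitions_in_rect_iff)
    ultimately show "r \<in> {..<l} \<and> j \<in> {..<k}" by fastforce
  qed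
qed simp

section \<open>Lattice words composed of weakly decreasing rows\<close>

lemma count_list_map_rev_upt:
  "count_list (map g (rev [a..<b])) x = card {j \<in> {a..<b}. g j = x}"
proof -
  have "count_list (map g (rev [a..<b])) x = length (filter (\<lambda>j. g j = x) (rev [a..<b]))"
    by (simp add: count_list_eq_length_filter filter_map o_def eq_commute)
  also have "\<dots> = card (set (filter (\<lambda>j. g j = x) (rev [a..<b])))"
    by (rule distinct_card[symmetric]) simp
  finally show ?thesis by simp
qed

lemma count_list_concat_upt:
  "count_list (concat (map f [0..<N])) x = (\<Sum>r<N. count_list (f r) x)"
  by (induction N) auto

text \<open>In a weakly decreasing block every \<open>i + 1\<close> precedes every \<open>i\<close>.
  So the worst prefix for \<open>i\<close> ends just after the last \<open>i + 1\<close> of the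
  block, before any \<open>i\<close> of the block is read.\<close>

lemma lattice_word_append:
  assumes "sorted_wrt (\<ge>) u"
  shows "lattice_word (v @ u) \<longleftrightarrow>
    lattice_word v \<and> (\<forall>i\<ge>1. count_list (v @ u) (i + 1) \<le> count_list v i)"
proof
  assume lat: "lattice_word (v @ u)"
  have "lattice_word v"
    unfolding lattice_word_def
  proof (intro allI impI)
    fix n i :: nat assume "1 \<le> i"
    moreover have "take (min n (length v)) (v @ u) = take n v" by (simp add: min_def)
    ultimately show "count_list (take n v) (i + 1) \<le> count_list (take n v) i"
      using lat unfolding lattice_word_def by metis
  qed
  moreover have "count_list (v @ u) (i + 1) \<le> count_list v i" if "1 \<le> i" for i
  proof -
    define p q where "p = takeWhile (\<lambda>x. i < x) u" and "q = dropWhile (\<lambda>x. i < x) u"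
    have u: "u = p @ q" by (simp add: p_def q_def)
    have "x \<le> i" if in_q: "x \<in> set q" for x
    proof -
      obtain y ys where q: "q = y # ys" using in_q by (cases q) auto
      then have "\<not> i < y" unfolding q_def by (simp add: dropWhile_eq_Cons_conv)
      then show ?thesis using assms in_q unfolding u q by (auto simp: sorted_wrt_append)
    qed
    then have "count_list q (i + 1) = 0" by (intro count_notin) fastforce
    moreover have "count_list p i = 0"
      by (intro count_notin) (auto simp: p_def dest: set_takeWhileD)
    moreover have "take (length v + length p) (v @ u) = v @ p" by (simp add: u)
    then have "count_list (v @ p) (i + 1) \<le> count_list (v @ p) i"
      using lat that unfolding lattice_word_def by metis
    ultimately show ?thesis by (simp add: u)
  qed
  ultimately show "lattice_word v \<and> (\<forall>i\<ge>1. count_list (v @ u) (i + 1) \<le> count_list v i)" by blast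
next
  assume *: "lattice_word v \<and> (\<forall>i\<ge>1. count_list (v @ u) (i + 1) \<le> count_list v i)"
  show "lattice_word (v @ u)"
    unfolding lattice_word_def
  proof (intro allI impI)
    fix n i :: nat assume i: "1 \<le> i"
    show "count_list (take n (v @ u)) (i + 1) \<le> count_list (take n (v @ u)) i"
    proof (cases "n \<le> length v")
      case True
      then show ?thesis using * i by (simp add: lattice_word_def)
    next
      case False
      have "count_list (take (n - length v) u) (i + 1) \<le> count_list u (i + 1)"
        by (metis append_take_drop_id count_list_append le_add1)
      moreover have "count_list (v @ u) (i + 1) \<le> count_list v i" using * i by blast
      ultimately show ?thesis using False by simp
    qed
  qed
qed

lemma lattice_word_concat:
  assumes "\<And>r. sorted_wrt (\<ge>) (f r)"
  shows "lattice_word (concat (map f [0..<N])) \<longleftrightarrow>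
    (\<forall>r<N. \<forall>i\<ge>1. (\<Sum>s\<le>r. count_list (f s) (i + 1)) \<le> (\<Sum>s<r. count_list (f s) i))"
proof (induction N)
  case 0
  then show ?case by (simp add: lattice_word_def)
next
  case (Suc N)
  have "lattice_word (concat (map f [0..<Suc N])) \<longleftrightarrow>
    lattice_word (concat (map f [0..<N]) @ f N)" by simp
  also have "\<dots> \<longleftrightarrow> (\<forall>r<Suc N. \<forall>i\<ge>1. (\<Sum>s\<le>r. count_list (f s) (i + 1)) \<le> (\<Sum>s<r. count_list (f s) i))"
    unfolding lattice_word_append[OF assms] Suc.IH
    by (auto simp: less_Suc_eq count_list_concat_upt lessThan_Suc_atMost[symmetric])
  finally show ?case .
qed

lemma num_rows_le:
  assumes "antimono \<alpha>" "finite {i. \<alpha> i \<noteq> 0}" "num_rows \<alpha> \<le> r"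
  shows "\<alpha> r = 0"
proof (rule ccontr)
  assume "\<alpha> r \<noteq> 0"
  have "{..r} \<subseteq> {i. \<alpha> i \<noteq> 0}"
  proof
    fix x assume "x \<in> {..r}"
    then have "\<alpha> r \<le> \<alpha> x" using assms(1) by (simp add: antimono_def)
    then show "x \<in> {i. \<alpha> i \<noteq> 0}" using \<open>\<alpha> r \<noteq> 0\<close> by simp
  qed
  then have "card {..r} \<le> num_rows \<alpha>" unfolding num_rows_def by (rule card_mono[OF assms(2)])
  then show False using assms(3) by simp
qed

text \<open>Chain and tableau are linked only by \<open>le_iff\<close>, so that the results serve
  both directions of the correspondence: a tableau made from a chain, and a chain made from a
  tableau.\<close>

locale chain_tableau =
  fixes k l :: nat and \<mu> \<Lambda> :: ptn and c :: "nat \<Rightarrow> ptn" and T :: "nat \<times> nat \<Rightarrow> nat"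
  assumes \<Lambda>: "\<Lambda> \<in> partitions_in_rect k l"
    and step: "c i r \<le> c (Suc i) r"
    and between: "\<mu> r \<le> c i r" "c i r \<le> \<Lambda> r"
    and le_iff: "\<mu> r \<le> j \<Longrightarrow> j < \<Lambda> r \<Longrightarrow> T (r, j) \<le> i \<longleftrightarrow> j < c i r"
begin

lemma letter_iff:
  "c i r \<le> j \<and> j < c (Suc i) r \<longleftrightarrow> \<mu> r \<le> j \<and> j < \<Lambda> r \<and> T (r, j) = Suc i"
proof (cases "\<mu> r \<le> j \<and> j < \<Lambda> r")
  case True
  then show ?thesis using le_iff[of r j i] le_iff[of r j "Suc i"] by linarith
next
  case False
  then show ?thesis using between(1)[of r i] between(2)[of "Suc i" r] by linarith
qed

lemma card_letter:
  "int (card {b \<in> skew_diagram \<Lambda> \<mu>. T b = Suc i}) = ptn_size l (c (Suc i)) - ptn_size l (c i)"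
proof -
  have "{b \<in> skew_diagram \<Lambda> \<mu>. T b = Suc i} = {(r, j). c i r \<le> j \<and> j < c (Suc i) r}"
    unfolding letter_iff by (auto simp: skew_diagram_iff)
  moreover have "c (Suc i) r = 0" if "l \<le> r" for r
    using between(2)[of "Suc i" r] \<Lambda> that by (simp add: partitions_in_rect_iff)
  ultimately show ?thesis using int_card_between[of "c i" "c (Suc i)" l] step by simp
qed

abbreviation row :: "nat \<Rightarrow> nat list" where
  "row r \<equiv> map (\<lambda>j. T (r, j)) (rev [\<mu> r..<\<Lambda> r])"

lemma count_row: "int (count_list (row r) (Suc i)) = int (c (Suc i) r) - int (c i r)"
proof -
  have "{j \<in> {\<mu> r..<\<Lambda> r}. T (r, j) = Suc i} = {c i r..<c (Suc i) r}"
    unfolding set_eq_iff atLeastLessThan_iff letter_iff by simp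
  then show ?thesis using step by (simp only: count_list_map_rev_upt card_atLeastLessThan of_nat_diff)
qed

lemma sorted_row: "sorted_wrt (\<ge>) (row r)"
proof -
  have "T (r, j) \<le> T (r, j')" if "\<mu> r \<le> j" "j < j'" "j' < \<Lambda> r" for j j'
    using le_iff[of r j' "T (r, j')"] le_iff[of r j "T (r, j')"] that by simp
  then show ?thesis
    by (simp add: sorted_wrt_map sorted_wrt_rev) (rule sorted_wrt_mono_rel[OF _ sorted_wrt_upt], auto)
qed

lemma lattice_word_iff_good: "lattice_word (reverse_row_word \<Lambda> \<mu> T) \<longleftrightarrow> good c"
proof -
  let ?R = "num_rows \<Lambda>"
  have lat: "lattice_word (concat (map row [0..<N])) \<longleftrightarrow> (\<forall>r<N. \<forall>i. \<not> violation c r i)" for N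
  proof -
    have "(\<Sum>s\<le>r. count_list (row s) (Suc i + 1)) \<le> (\<Sum>s<r. count_list (row s) (Suc i)) \<longleftrightarrow>
      \<not> violation c r i" for r i
      unfolding violation_def not_less count_row[symmetric]
      by (simp add: of_nat_sum[symmetric] del: of_nat_sum)
    moreover have "(\<forall>i\<ge>1. P i) \<longleftrightarrow> (\<forall>i. P (Suc i))" for P :: "nat \<Rightarrow> bool"
      by (metis One_nat_def Suc_le_D Suc_le_mono zero_le)
    ultimately show ?thesis
      unfolding lattice_word_concat[OF sorted_row] by simp
  qed
  have part: "antimono \<Lambda>" "finite {i. \<Lambda> i \<noteq> 0}"
    using \<Lambda> by (auto simp: partitions_in_rect_def is_partition_def)
  \<comment> \<open>The word ends with the last nonempty row, whereas \<open>good\<close> concerns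
    all rows; appending empty rows does not change the word.\<close>
  have "concat (map row [0..<?R + d]) = concat (map row [0..<?R])" for d
    using num_rows_le[OF part] by (induction d) auto
  then have "lattice_word (reverse_row_word \<Lambda> \<mu> T) \<longleftrightarrow> lattice_word (concat (map row [0..<?R + d]))" for d
    by (simp add: reverse_row_word_def)
  then have "lattice_word (reverse_row_word \<Lambda> \<mu> T) \<longleftrightarrow> (\<forall>r<?R + d. \<forall>i. \<not> violation c r i)" for d
    using lat by blast
  then show ?thesis
    unfolding good_def by (metis less_Suc_eq_le le_add2 add_Suc_right)
qed

end

section \<open>The bijection between chains and tableaux\<close>

definition tableau_of :: "ptn \<Rightarrow> ptn \<Rightarrow> (nat \<Rightarrow> ptn) \<Rightarrow> nat \<times> nat \<Rightarrow> nat" where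
  "tableau_of \<mu> \<Lambda> c = (\<lambda>(r, j). if \<mu> r \<le> j \<and> j < \<Lambda> r then LEAST i. j < c i r else 0)"

lemma strip_chains_mono:
  assumes "c \<in> strip_chains k l n b \<mu> \<Lambda>" "i \<le> i'"
  shows "c i r \<le> c i' r"
  using lift_Suc_mono_le[of "\<lambda>i. c i r" i i'] assms by (simp add: strip_chains_def horizontal_strip_def)

lemma strip_chains_between:
  assumes "c \<in> strip_chains k l n b \<mu> \<Lambda>"
  shows "\<mu> r \<le> c i r" "c i r \<le> \<Lambda> r"
  \<comment> \<open>At index \<open>max i n\<close> the chain has reached
    \<open>\<Lambda>\<close>.\<close>
  using strip_chains_mono[OF assms, of 0 i r] strip_chains_mono[OF assms, of i "max i n" r] assms
  by (auto simp: strip_chains_def)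

lemma chain_tableau_tableau_of:
  assumes c: "c \<in> strip_chains k l n b \<mu> \<Lambda>" and \<Lambda>: "\<Lambda> \<in> partitions_in_rect k l"
  shows "chain_tableau k l \<mu> \<Lambda> c (tableau_of \<mu> \<Lambda> c)"
proof
  fix i r j
  show "\<Lambda> \<in> partitions_in_rect k l" "c i r \<le> c (Suc i) r" "\<mu> r \<le> c i r" "c i r \<le> \<Lambda> r"
    using \<Lambda> strip_chains_mono[OF c, of i "Suc i"] strip_chains_between[OF c] by auto
  assume j: "\<mu> r \<le> j" "j < \<Lambda> r"
  have "j < c n r" using c j by (simp add: strip_chains_def)
  then have "j < c (LEAST i. j < c i r) r" by (rule LeastI)
  then show "tableau_of \<mu> \<Lambda> c (r, j) \<le> i \<longleftrightarrow> j < c i r"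
    using j strip_chains_mono[OF c] by (auto simp: tableau_of_def intro: Least_le less_le_trans)
qed

text \<open>Columns increase strictly because in a horizontal strip the box above any box of
  \<open>c (Suc i)\<close> already lies in \<open>c i\<close>.\<close>

lemma tableau_of_semistandard:
  assumes c: "c \<in> strip_chains k l n b \<mu> \<Lambda>" and \<Lambda>: "\<Lambda> \<in> partitions_in_rect k l"
  shows "tableau_of \<mu> \<Lambda> c \<in> semistandard_tableaux \<Lambda> \<mu>"
proof -
  let ?T = "tableau_of \<mu> \<Lambda> c"
  interpret chain_tableau k l \<mu> \<Lambda> c ?T by (rule chain_tableau_tableau_of[OF c \<Lambda>])
  have anti: "antimono (c i)" for i
    using c by (auto simp: strip_chains_def partitions_in_rect_iff)
  have pos: "?T (r, j) \<noteq> 0" if "(r, j) \<in> skew_diagram \<Lambda> \<mu>" for r j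
    using le_iff[of r j 0] c that by (auto simp: skew_diagram_iff strip_chains_def)
  have "?T (r, j) \<le> ?T (r, j')"
    if "(r, j) \<in> skew_diagram \<Lambda> \<mu>" "(r, j') \<in> skew_diagram \<Lambda> \<mu>" "j \<le> j'" for r j j'
    using le_iff[of r j' "?T (r, j')"] le_iff[of r j "?T (r, j')"] that by (simp add: skew_diagram_iff)
  moreover have "?T (r, j) < ?T (r', j)"
    if rj: "(r, j) \<in> skew_diagram \<Lambda> \<mu>" "(r', j) \<in> skew_diagram \<Lambda> \<mu>" "r < r'" for r r' j
  proof -
    obtain i where i: "?T (r', j) = Suc i" using pos[OF rj(2)] not0_implies_Suc by blast
    have "j < c (Suc i) r'" using le_iff[of r' j "Suc i"] i rj by (simp add: skew_diagram_iff)
    also have "\<dots> \<le> c (Suc i) (Suc r)" using anti rj(3) by (simp add: antimono_def)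
    also have "\<dots> \<le> c i r" using c by (simp add: strip_chains_def horizontal_strip_def)
    finally show ?thesis using le_iff[of r j i] i rj by (simp add: skew_diagram_iff)
  qed
  moreover have "b \<in> skew_diagram \<Lambda> \<mu> \<longleftrightarrow> ?T b \<noteq> 0" for b
    using pos by (cases b) (auto simp: tableau_of_def skew_diagram_iff split: if_splits)
  ultimately show ?thesis by (simp add: semistandard_tableaux_def)
qed

lemma inj_on_tableau_of:
  assumes "\<Lambda> \<in> partitions_in_rect k l"
  shows "inj_on (tableau_of \<mu> \<Lambda>) (strip_chains k l n b \<mu> \<Lambda>)"
proof (rule inj_onI, intro ext)
  fix c d i r
  assume c: "c \<in> strip_chains k l n b \<mu> \<Lambda>" and d: "d \<in> strip_chains k l n b \<mu> \<Lambda>"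
    and eq: "tableau_of \<mu> \<Lambda> c = tableau_of \<mu> \<Lambda> d"
  interpret c: chain_tableau k l \<mu> \<Lambda> c "tableau_of \<mu> \<Lambda> c" by (rule chain_tableau_tableau_of[OF c assms])
  interpret d: chain_tableau k l \<mu> \<Lambda> d "tableau_of \<mu> \<Lambda> d" by (rule chain_tableau_tableau_of[OF d assms])
  have key: "j < c i r \<longleftrightarrow> j < d i r" if "\<mu> r \<le> j" "j < \<Lambda> r" for j
    using c.le_iff[OF that, of i] d.le_iff[OF that, of i] eq by simp
  show "c i r = d i r"
    using key[of "c i r"] key[of "d i r"] c.between(1)[of r i] c.between(2)[of i r]
      d.between(1)[of r i] d.between(2)[of i r]
    by (cases "c i r" "d i r" rule: linorder_cases) auto
qed

text \<open>The chain collects \<open>\<mu>\<close> and the boxes with letters at most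
  \<open>i\<close>. Weakly increasing rows make these boxes initial segments, strictly increasing
  columns give horizontal strips, and since \<open>\<nu>\<close> has at most \<open>l\<close>
  nonzero parts the chain reaches \<open>\<Lambda>\<close> by index \<open>l\<close>.\<close>

lemma semistandard_eq_tableau_of:
  assumes T: "T \<in> semistandard_tableaux \<Lambda> \<mu>" "has_content \<Lambda> \<mu> T \<nu>"
    and in_rect: "\<mu> \<in> partitions_in_rect k l" "\<Lambda> \<in> partitions_in_rect k l" "\<nu> \<in> partitions_in_rect k l"
    and sub: "diagram \<mu> \<subseteq> diagram \<Lambda>"
  obtains c where "c \<in> strip_chains k l l (\<lambda>i. int (\<nu> i)) \<mu> \<Lambda>" "tableau_of \<mu> \<Lambda> c = T"
proof -
  define A where "A i r = {j \<in> {\<mu> r..<\<Lambda> r}. T (r, j) \<le> i}" for i r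
  define c where "c i r = \<mu> r + card (A i r)" for i r
  have "\<forall>b. b \<in> skew_diagram \<Lambda> \<mu> \<longleftrightarrow> T b \<noteq> 0"
    using T(1) unfolding semistandard_tableaux_def mem_Collect_eq by (rule conjunct1)
  then have zero: "T b \<noteq> 0 \<longleftrightarrow> b \<in> skew_diagram \<Lambda> \<mu>" for b by blast
  have row: "T (r, j) \<le> T (r, j')" if "\<mu> r \<le> j" "j \<le> j'" "j' < \<Lambda> r" for r j j'
    using T(1) that by (auto simp: semistandard_tableaux_def skew_diagram_iff)
  have col: "T (r, j) < T (r', j)" if "\<mu> r \<le> j" "j < \<Lambda> r" "\<mu> r' \<le> j" "j < \<Lambda> r'" "r < r'" for r r' j
    using T(1) that by (auto simp: semistandard_tableaux_def skew_diagram_iff)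
  have le: "\<mu> r \<le> \<Lambda> r" for r using sub by (simp add: diagram_subset_iff)
  have finA: "finite (A i r)" for i r by (simp add: A_def)
  have c_le: "c i r \<le> \<Lambda> r" for i r
  proof -
    have "card (A i r) \<le> card {\<mu> r..<\<Lambda> r}" by (rule card_mono) (auto simp: A_def)
    then show ?thesis using le[of r] by (simp add: c_def)
  qed
  have A_eq: "A i r = {\<mu> r..<c i r}" for i r
  proof -
    have down: "j \<in> A i r" if "j' \<in> A i r" "\<mu> r \<le> j" "j \<le> j'" for j j'
      using that row[of r j j'] by (auto simp: A_def)
    show ?thesis
    proof (cases "A i r = {}")
      case False
      then have max: "Max (A i r) \<in> A i r" "\<And>j. j \<in> A i r \<Longrightarrow> j \<le> Max (A i r)" using finA by auto
      have "A i r = {\<mu> r..<Suc (Max (A i r))}"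
        using down[OF max(1)] max(2) by (auto simp: less_Suc_eq_le) (simp add: A_def)
      moreover from this have "c i r = Suc (Max (A i r))"
        using max(1) unfolding c_def by (metis (no_types, lifting) A_def atLeastLessThan_iff
          card_atLeastLessThan le_SucI le_add_diff_inverse mem_Collect_eq)
      ultimately show ?thesis by simp
    qed (simp add: c_def)
  qed
  have le_iff: "T (r, j) \<le> i \<longleftrightarrow> j < c i r" if "\<mu> r \<le> j" "j < \<Lambda> r" for r j i
  proof -
    have "j \<in> A i r \<longleftrightarrow> j \<in> {\<mu> r..<c i r}" by (simp only: A_eq)
    then show ?thesis using that by (simp add: A_def)
  qed
  have step: "c i r \<le> c (Suc i) r" for i r
    using card_mono[OF finA, of "A i r" "Suc i" r] by (fastforce simp: c_def A_def)
  interpret chain_tableau k l \<mu> \<Lambda> c T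
    by unfold_locales (use in_rect step c_le le_iff in \<open>auto simp: c_def\<close>)
  have content: "int (\<nu> i) = ptn_size l (c (Suc i)) - ptn_size l (c i)" for i
    using card_letter[of i] T(2) by (simp add: has_content_def)
  have "c 0 = \<mu>"
    using zero by (auto simp: c_def A_def fun_eq_iff skew_diagram_iff)
  moreover have "c i = \<Lambda>" if "l \<le> i" for i
  proof
    fix r
    have "T (r, j) \<le> i" if j: "\<mu> r \<le> j" "j < \<Lambda> r" for j
    proof (rule ccontr)
      assume "\<not> ?thesis"
      then obtain m where m: "T (r, j) = Suc m" "i \<le> m" by (cases "T (r, j)") auto
      have "{b \<in> skew_diagram \<Lambda> \<mu>. T b = Suc m} \<noteq> {}" using m j by (auto simp: skew_diagram_iff)
      then have "card {b \<in> skew_diagram \<Lambda> \<mu>. T b = Suc m} \<noteq> 0"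
        using finite_skew_diagram[OF in_rect(2)] by simp
      then have "\<nu> m \<noteq> 0" using T(2) by (simp add: has_content_def)
      then show False using in_rect(3) m(2) \<open>l \<le> i\<close> by (auto simp: partitions_in_rect_iff)
    qed
    then have "A i r = {\<mu> r..<\<Lambda> r}" by (auto simp: A_def)
    then show "c i r = \<Lambda> r" using le[of r] by (simp add: c_def)
  qed
  moreover have strip: "horizontal_strip (c i) (c (Suc i))" for i
    unfolding horizontal_strip_def
  proof (intro allI conjI step)
    fix r
    have anti: "\<mu> (Suc r) \<le> \<mu> r" "\<Lambda> (Suc r) \<le> \<Lambda> r"
      using in_rect by (auto simp: partitions_in_rect_iff antimono_def)
    show "c (Suc i) (Suc r) \<le> c i r"
    proof (rule ccontr)
      assume "\<not> ?thesis"
      then have *: "c i r < c (Suc i) (Suc r)" by simp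
      then have in_skew: "\<mu> r \<le> c i r" "c i r < \<Lambda> r" "\<mu> (Suc r) \<le> c i r" "c i r < \<Lambda> (Suc r)"
        using between[of r i] between(2)[of "Suc i" "Suc r"] anti by auto
      have "T (Suc r, c i r) \<le> Suc i" using le_iff[of "Suc r" "c i r" "Suc i"] in_skew * by simp
      moreover have "T (r, c i r) < T (Suc r, c i r)" using col in_skew by simp
      ultimately have "T (r, c i r) \<le> i" by simp
      then show False using le_iff[of r "c i r" i] in_skew by simp
    qed
  qed
  moreover have "c i \<in> partitions_in_rect k l" for i
  proof -
    have "antimono (c i)"
      using strip by (intro decseq_SucI) (meson horizontal_stripD order_trans)
    then show ?thesis
      using in_rect(2) c_le unfolding partitions_in_rect_iff by (metis le_zero_eq order_trans)
  qed
  ultimately have c: "c \<in> strip_chains k l l (\<lambda>i. int (\<nu> i)) \<mu> \<Lambda>"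
    using content by (simp add: strip_chains_def)
  interpret c: chain_tableau k l \<mu> \<Lambda> c "tableau_of \<mu> \<Lambda> c"
    by (rule chain_tableau_tableau_of[OF c in_rect(2)])
  have "tableau_of \<mu> \<Lambda> c (r, j) = T (r, j)" for r j
  proof (cases "\<mu> r \<le> j \<and> j < \<Lambda> r")
    case True
    then show ?thesis using c.le_iff[of r j] le_iff[of r j] by (metis order_antisym order_refl)
  next
    case False
    then show ?thesis using zero[of "(r, j)"] by (auto simp: tableau_of_def skew_diagram_iff)
  qed
  then have "tableau_of \<mu> \<Lambda> c = T" by auto
  then show thesis using that c by blast
qed

text \<open>Under \<open>tableau_of\<close> the good chains correspond to the Littlewood-Richardson
  tableaux. If \<open>\<mu>\<close> is not contained in \<open>\<Lambda>\<close>, there are no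
  chains.\<close>

lemma lr_coeff_eq_jacobi_trudi:
  assumes in_rect: "\<mu> \<in> partitions_in_rect k l" "\<Lambda> \<in> partitions_in_rect k l" "\<nu> \<in> partitions_in_rect k l"
  shows "int (lr_coeff \<Lambda> \<mu> \<nu>) = jacobi_trudi k l \<nu> \<mu> \<Lambda>"
proof (cases "diagram \<mu> \<subseteq> diagram \<Lambda>")
  case True
  let ?C = "{c \<in> strip_chains k l l (\<lambda>i. int (\<nu> i)) \<mu> \<Lambda>. good c}"
  let ?T = "{T \<in> semistandard_tableaux \<Lambda> \<mu>. has_content \<Lambda> \<mu> T \<nu> \<and> lattice_word (reverse_row_word \<Lambda> \<mu> T)}"
  have "tableau_of \<mu> \<Lambda> c \<in> ?T" if "c \<in> ?C" for c
  proof -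
    have c: "c \<in> strip_chains k l l (\<lambda>i. int (\<nu> i)) \<mu> \<Lambda>" "good c" using that by auto
    interpret chain_tableau k l \<mu> \<Lambda> c "tableau_of \<mu> \<Lambda> c"
      by (rule chain_tableau_tableau_of[OF c(1) in_rect(2)])
    have "ptn_size l (c (Suc i)) - ptn_size l (c i) = int (\<nu> i)" for i
    proof (cases "i < l")
      case False
      then have "c (Suc i) = \<Lambda>" "c i = \<Lambda>" "\<nu> i = 0"
        using c(1) in_rect(3) by (auto simp: strip_chains_def partitions_in_rect_iff)
      then show ?thesis by simp
    qed (use c(1) in \<open>simp add: strip_chains_def\<close>)
    then have "has_content \<Lambda> \<mu> (tableau_of \<mu> \<Lambda> c) \<nu>"
      using card_letter unfolding has_content_def by (metis of_nat_eq_iff)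
    then show ?thesis
      using tableau_of_semistandard[OF c(1) in_rect(2)] lattice_word_iff_good c(2) by simp
  qed
  moreover have "T \<in> tableau_of \<mu> \<Lambda> ` ?C" if "T \<in> ?T" for T
  proof -
    have T: "T \<in> semistandard_tableaux \<Lambda> \<mu>" "has_content \<Lambda> \<mu> T \<nu>" "lattice_word (reverse_row_word \<Lambda> \<mu> T)"
      using that by auto
    obtain c where c: "c \<in> strip_chains k l l (\<lambda>i. int (\<nu> i)) \<mu> \<Lambda>" "tableau_of \<mu> \<Lambda> c = T"
      using semistandard_eq_tableau_of[OF T(1,2) in_rect True] .
    interpret chain_tableau k l \<mu> \<Lambda> c "tableau_of \<mu> \<Lambda> c"
      by (rule chain_tableau_tableau_of[OF c(1) in_rect(2)])
    have "good c" using lattice_word_iff_good T(3) c(2) by simp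
    then show ?thesis using c by blast
  qed
  ultimately have "tableau_of \<mu> \<Lambda> ` ?C = ?T" by blast
  moreover have "inj_on (tableau_of \<mu> \<Lambda>) ?C"
    by (rule inj_on_subset[OF inj_on_tableau_of[OF in_rect(2)]]) blast
  then have "card (tableau_of \<mu> \<Lambda> ` ?C) = card ?C" by (rule card_image)
  ultimately have "card ?T = card ?C" by (simp only:)
  then show ?thesis using True by (simp add: lr_coeff_def jacobi_trudi_eq_card[OF in_rect])
next
  case False
  then have "strip_chains k l l (\<lambda>i. int (\<nu> i)) \<mu> \<Lambda> = {}"
    unfolding diagram_subset_iff by (meson all_not_in_conv order_trans strip_chains_between)
  then show ?thesis using False by (simp add: lr_coeff_def jacobi_trudi_eq_card[OF in_rect])
qed


section \<open>Symmetry of the Littlewood-Richardson coefficients\<close>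

text \<open>A Littlewood-Richardson tableau of straight shape has only the letter
  \<open>r + 1\<close> in row \<open>r\<close>: strictly increasing columns exclude smaller letters
  and, by induction on \<open>r\<close>, the lattice condition excludes larger ones.\<close>

lemma good_chain_from_zero:
  assumes c: "c \<in> strip_chains k l n b (\<lambda>_. 0) \<kappa>" and good: "good c"
  shows "c i r = (if r < i then \<kappa> r else 0)"
proof -
  have strip: "c i r \<le> c (Suc i) r" "c (Suc i) (Suc r) \<le> c i r" for i r
    using c by (auto simp: strip_chains_def horizontal_strip_def)
  have zero: "c i r = 0" if "i \<le> r" for i r
    using that
  proof (induction i arbitrary: r)
    case 0
    then show ?case using c by (simp add: strip_chains_def)
  next
    case (Suc i)
    then obtain s where s: "r = Suc s" "i \<le> s" by (cases r) auto
    then show ?case using strip(2)[of i s] Suc.IH by simp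
  qed
  have const: "c (Suc i) r = c i r" if "r < i" for i r
    using that
  proof (induction r arbitrary: i rule: less_induct)
    case (less r)
    then obtain m where m: "i = Suc m" "r \<le> m" by (cases i) auto
    have "\<not> violation c r m" using good by (simp add: good_def)
    moreover have "(\<Sum>j<r. int (c (Suc m) j) - int (c m j)) = 0"
      using less.IH m by (intro sum.neutral) simp
    ultimately have "(\<Sum>j\<le>r. int (c (Suc (Suc m)) j) - int (c (Suc m) j)) \<le> 0"
      by (simp add: violation_def)
    moreover have "int (c (Suc (Suc m)) r) - int (c (Suc m) r) \<le> (\<Sum>j\<le>r. int (c (Suc (Suc m)) j) - int (c (Suc m) j))"
      using strip by (intro member_le_sum) auto
    ultimately show ?case using strip(1)[of "Suc m" r] m by simp
  qed
  have "c (i + d) r = c i r" if "r < i" for d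
    using const that by (induction d) auto
  \<comment> \<open>After \<open>n\<close> further steps the chain has certainly reached
    \<open>\<kappa>\<close>.\<close>
  from this[of n] have "c i r = \<kappa> r" if "r < i"
    using c that by (simp add: strip_chains_def)
  then show ?thesis using zero by simp
qed

text \<open>The only candidate for a good chain is \<open>c0\<close>, and its content is its own
  shape \<open>\<kappa>\<close>.\<close>

lemma jacobi_trudi_zero:
  assumes \<alpha>: "\<alpha> \<in> partitions_in_rect k l" and \<kappa>: "\<kappa> \<in> partitions_in_rect k l"
  shows "jacobi_trudi k l \<alpha> (\<lambda>_. 0) \<kappa> = of_bool (\<alpha> = \<kappa>)"
proof -
  define c0 where "c0 i r = (if r < i then \<kappa> r else 0)" for i r
  let ?C = "{c \<in> strip_chains k l l (\<lambda>i. int (\<alpha> i)) (\<lambda>_. 0) \<kappa>. good c}"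
  have size: "ptn_size l (c0 (Suc i)) - ptn_size l (c0 i) = int (\<kappa> i)" if "i < l" for i
  proof -
    have "ptn_size l (c0 (Suc i)) - ptn_size l (c0 i) = (\<Sum>r<l. if r = i then int (\<kappa> i) else 0)"
      unfolding ptn_size_def sum_subtractf[symmetric] by (intro sum.cong) (auto simp: c0_def)
    then show ?thesis using that by simp
  qed
  have anti: "antimono \<kappa>" "\<And>i. \<kappa> i \<le> k" "\<And>i. l \<le> i \<Longrightarrow> \<kappa> i = 0"
    using \<kappa> by (auto simp: partitions_in_rect_iff)
  have "c = c0 \<and> \<alpha> = \<kappa>" if "c \<in> ?C" for c
  proof -
    have c: "c = c0"
      using good_chain_from_zero that by (fastforce simp: c0_def fun_eq_iff)
    then have "\<alpha> i = \<kappa> i" if "i < l" for i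
      using \<open>c \<in> ?C\<close> size[OF that] that by (simp add: strip_chains_def)
    moreover have "\<alpha> i = \<kappa> i" if "\<not> i < l" for i
      using \<alpha> anti that by (simp add: partitions_in_rect_iff)
    ultimately show ?thesis using c by blast
  qed
  moreover have "c0 \<in> ?C" if "\<alpha> = \<kappa>"
  proof -
    have "antimono (c0 i)" for i
      using anti(1) by (auto simp: c0_def antimono_def)
    then have "c0 i \<in> partitions_in_rect k l" for i
      using anti by (simp add: partitions_in_rect_iff c0_def)
    moreover have "horizontal_strip (c0 i) (c0 (Suc i))" for i
      using anti(1) by (auto simp: horizontal_strip_def c0_def antimono_def)
    moreover have "c0 i = \<kappa>" if "l \<le> i" for i
      using anti(3) that by (auto simp: c0_def fun_eq_iff)
    moreover have "c0 0 = (\<lambda>_. 0)" by (simp add: c0_def fun_eq_iff)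
    ultimately have "c0 \<in> strip_chains k l l (\<lambda>i. int (\<alpha> i)) (\<lambda>_. 0) \<kappa>"
      using size that by (simp add: strip_chains_def)
    moreover have "\<not> violation c0 r i" for r i
    proof -
      have diff: "int (c0 (Suc m) j) - int (c0 m j) = (if j = m then int (\<kappa> m) else 0)" for m j
        by (auto simp: c0_def)
      have "\<kappa> (Suc i) \<le> \<kappa> i" using anti(1) by (simp add: antimono_def)
      then show ?thesis by (simp add: violation_def diff)
    qed
    ultimately show ?thesis by (simp add: good_def)
  qed
  ultimately have "?C = (if \<alpha> = \<kappa> then {c0} else {})" by auto
  then show ?thesis
    using jacobi_trudi_eq_card[OF zero_in_partitions_in_rect \<kappa> \<alpha>] by simp
qed

text \<open>In the row of the empty partition, \<open>jacobi_trudi_zero\<close> collapses each side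
  of the commutation relation to a single term.\<close>

lemma jacobi_trudi_symmetric:
  assumes "l > 0" "\<mu> \<in> partitions_in_rect k l" "\<nu> \<in> partitions_in_rect k l"
  shows "jacobi_trudi k l \<nu> \<mu> \<Lambda> = jacobi_trudi k l \<mu> \<nu> \<Lambda>"
proof -
  have "(\<Sum>\<kappa>\<in>partitions_in_rect k l. jacobi_trudi k l \<mu> (\<lambda>_. 0) \<kappa> * jacobi_trudi k l \<nu> \<kappa> \<Lambda>) =
    jacobi_trudi k l \<nu> \<mu> \<Lambda>" if "\<mu> \<in> partitions_in_rect k l" for \<mu> \<nu>
  proof -
    have "(\<Sum>\<kappa>\<in>partitions_in_rect k l. jacobi_trudi k l \<mu> (\<lambda>_. 0) \<kappa> * jacobi_trudi k l \<nu> \<kappa> \<Lambda>) =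
      (\<Sum>\<kappa>\<in>partitions_in_rect k l. if \<kappa> = \<mu> then jacobi_trudi k l \<nu> \<kappa> \<Lambda> else 0)"
      using that by (intro sum.cong) (auto simp: jacobi_trudi_zero)
    then show ?thesis using that finite_partitions_in_rect by simp
  qed
  then show ?thesis
    using jacobi_trudi_commute[OF assms(1) zero_in_partitions_in_rect[of k l], of \<mu> \<nu> \<Lambda>] assms by metis
qed

proposition lr_coeff_rect_compl:
  assumes "l > 0" "\<mu> \<in> partitions_in_rect k l" "\<nu> \<in> partitions_in_rect k l" "\<Lambda> \<in> partitions_in_rect k l"
  shows "lr_coeff \<Lambda> \<mu> \<nu> = lr_coeff (rect_compl k l \<nu>) \<mu> (rect_compl k l \<Lambda>)"
proof -
  note in_rect = assms(2-4) rect_compl_in_rect[OF assms(3)] rect_compl_in_rect[OF assms(4)]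
  have "int (lr_coeff \<Lambda> \<mu> \<nu>) = jacobi_trudi k l \<nu> \<mu> \<Lambda>"
    using in_rect by (simp add: lr_coeff_eq_jacobi_trudi)
  also have "\<dots> = jacobi_trudi k l \<mu> \<nu> \<Lambda>"
    by (rule jacobi_trudi_symmetric) fact+
  also have "\<dots> = jacobi_trudi k l \<mu> (rect_compl k l \<Lambda>) (rect_compl k l \<nu>)"
    by (rule jacobi_trudi_rect_compl[symmetric]) fact+
  also have "\<dots> = jacobi_trudi k l (rect_compl k l \<Lambda>) \<mu> (rect_compl k l \<nu>)"
    using in_rect by (intro jacobi_trudi_symmetric assms)
  also have "\<dots> = int (lr_coeff (rect_compl k l \<nu>) \<mu> (rect_compl k l \<Lambda>))"
    using in_rect by (simp add: lr_coeff_eq_jacobi_trudi)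
  finally show ?thesis by simp
qed


section \<open>Linear independence of irreducible characters\<close>

lemma carrier_sym_group: "carrier (sym_group m) = {p. p permutes {1..m}}"
  by (simp add: sym_group_def)

lemma finite_carrier_sym_group: "finite (carrier (sym_group m))"
  by (simp add: carrier_sym_group finite_permutations)

lemma sym_group_closed:
  assumes "p \<in> carrier (sym_group m)"
  shows "q \<in> carrier (sym_group m) \<Longrightarrow> p \<circ> q \<in> carrier (sym_group m)"
    and "Hilbert_Choice.inv p \<in> carrier (sym_group m)"
    and "Hilbert_Choice.inv p \<circ> p = id" "p \<circ> Hilbert_Choice.inv p = id"
proof -
  have p: "p permutes {1..m}" using assms by (simp add: carrier_sym_group)
  show "p \<circ> q \<in> carrier (sym_group m)" if "q \<in> carrier (sym_group m)"
    using permutes_compose[OF _ p, of q] that by (simp add: carrier_sym_group)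
  show "Hilbert_Choice.inv p \<in> carrier (sym_group m)"
    using permutes_inv[OF p] by (simp add: carrier_sym_group)
  show "Hilbert_Choice.inv p \<circ> p = id" "p \<circ> Hilbert_Choice.inv p = id"
    by (rule permutes_inv_o[OF p])+
qed

lemma id_in_sym_group: "id \<in> carrier (sym_group m)"
  by (simp add: carrier_sym_group permutes_id)

lemma sum_sym_group_translate:
  assumes "h \<in> carrier (sym_group m)"
  shows "(\<Sum>g\<in>carrier (sym_group m). f (h \<circ> g)) = (\<Sum>g\<in>carrier (sym_group m). f g)"
proof (rule sum.reindex_bij_witness[where j = "\<lambda>g. h \<circ> g" and i = "\<lambda>g. Hilbert_Choice.inv h \<circ> g"])
  fix g assume "g \<in> carrier (sym_group m)"
  then show "h \<circ> g \<in> carrier (sym_group m)" "Hilbert_Choice.inv h \<circ> g \<in> carrier (sym_group m)"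
    "Hilbert_Choice.inv h \<circ> (h \<circ> g) = g" "h \<circ> (Hilbert_Choice.inv h \<circ> g) = g"
    using sym_group_closed[OF assms] sym_group_closed(1)[of "Hilbert_Choice.inv h"]
    by (auto simp: comp_assoc[symmetric])
qed simp

lemma mult_mat_index:
  "A \<in> carrier_mat n m \<Longrightarrow> B \<in> carrier_mat m k \<Longrightarrow> i < n \<Longrightarrow> j < k \<Longrightarrow>
    (A * B) $$ (i, j) = (\<Sum>a<m. A $$ (i, a) * B $$ (a, j))"
  by (simp add: scalar_prod_def atLeast0LessThan)

lemma mat_eq_by_action:
  fixes A B :: "'a :: comm_ring_1 Matrix.mat"
  assumes "A \<in> carrier_mat n m" "B \<in> carrier_mat n m"
    and "\<And>v. v \<in> carrier_vec m \<Longrightarrow> A *\<^sub>v v = B *\<^sub>v v"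
  shows "A = B"
proof (rule eq_matI)
  fix i j assume "i < dim_row B" "j < dim_col B"
  then have ij: "i < n" "j < m" using assms by auto
  have "M $$ (i, j) = (M *\<^sub>v unit_vec m j) $ i" if "M \<in> carrier_mat n m" for M :: "'a Matrix.mat"
    using that ij by simp
  then show "A $$ (i, j) = B $$ (i, j)" using assms by simp
qed (use assms in auto)

lemma trace_commute:
  fixes A B :: "'a :: comm_ring_1 Matrix.mat"
  assumes "A \<in> carrier_mat n m" "B \<in> carrier_mat m n"
  shows "(\<Sum>i<n. (A * B) $$ (i, i)) = (\<Sum>i<m. (B * A) $$ (i, i))"
proof -
  have "(\<Sum>i<n. (A * B) $$ (i, i)) = (\<Sum>i<n. \<Sum>j<m. A $$ (i, j) * B $$ (j, i))"
    using assms by (simp add: mult_mat_index del: index_mult_mat)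
  also have "\<dots> = (\<Sum>j<m. \<Sum>i<n. B $$ (j, i) * A $$ (i, j))"
    by (subst sum.swap) (simp add: mult.commute)
  also have "\<dots> = (\<Sum>j<m. (B * A) $$ (j, j))"
    using assms by (simp add: mult_mat_index del: index_mult_mat)
  finally show ?thesis .
qed

section \<open>Schur's lemma for matrix representations\<close>

lemma sym_matrix_repD:
  assumes "sym_matrix_rep m d \<rho>"
  shows "p \<in> carrier (sym_group m) \<Longrightarrow> \<rho> p \<in> carrier_mat d d"
    and "\<rho> id = 1\<^sub>m d"
    and "p \<in> carrier (sym_group m) \<Longrightarrow> q \<in> carrier (sym_group m) \<Longrightarrow> \<rho> (p \<circ> q) = \<rho> p * \<rho> q"
  using assms unfolding sym_matrix_rep_def by blast+

lemma irreducible_repD: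
  assumes "irreducible_rep m d \<rho>" "complex_subspace d W"
    and "\<And>p w. p \<in> carrier (sym_group m) \<Longrightarrow> w \<in> W \<Longrightarrow> \<rho> p *\<^sub>v w \<in> W"
  shows "W = {0\<^sub>v d} \<or> W = carrier_vec d"
proof -
  have "\<forall>W. complex_subspace d W \<and> (\<forall>p \<in> carrier (sym_group m). \<forall>w \<in> W. \<rho> p *\<^sub>v w \<in> W)
        \<longrightarrow> W = {0\<^sub>v d} \<or> W = carrier_vec d"
    using assms(1) unfolding irreducible_rep_def by simp
  then show ?thesis using assms(2,3) by simp
qed

locale intertwiner =
  fixes m d d' :: nat and \<rho> \<rho>' :: "(nat \<Rightarrow> nat) \<Rightarrow> complex Matrix.mat" and M :: "complex Matrix.mat"
  assumes rep: "sym_matrix_rep m d \<rho>" "sym_matrix_rep m d' \<rho>'"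
    and M: "M \<in> carrier_mat d d'"
    and intertwines: "p \<in> carrier (sym_group m) \<Longrightarrow> \<rho> p * M = M * \<rho>' p"
begin

lemma intertwines_vec:
  assumes "p \<in> carrier (sym_group m)" "v \<in> carrier_vec d'"
  shows "M *\<^sub>v (\<rho>' p *\<^sub>v v) = \<rho> p *\<^sub>v (M *\<^sub>v v)"
proof -
  have "M *\<^sub>v (\<rho>' p *\<^sub>v v) = (M * \<rho>' p) *\<^sub>v v"
    using M sym_matrix_repD(1)[OF rep(2) assms(1)] assms(2) by simp
  also have "\<dots> = (\<rho> p * M) *\<^sub>v v" using intertwines assms(1) by simp
  also have "\<dots> = \<rho> p *\<^sub>v (M *\<^sub>v v)"
    using M sym_matrix_repD(1)[OF rep(1) assms(1)] assms(2) by simp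
  finally show ?thesis .
qed

text \<open>The kernel is an invariant subspace, and it is proper because \<open>M\<close> is not
  zero.\<close>

lemma kernel_trivial:
  assumes "irreducible_rep m d' \<rho>'" "M \<noteq> 0\<^sub>m d d'" "v \<in> carrier_vec d'" "M *\<^sub>v v = 0\<^sub>v d"
  shows "v = 0\<^sub>v d'"
proof -
  let ?W = "{v \<in> carrier_vec d'. M *\<^sub>v v = 0\<^sub>v d}"
  have "complex_subspace d' ?W"
    using M by (auto simp: complex_subspace_def mult_add_distrib_mat_vec mult_mat_vec)
  moreover have "\<rho>' p *\<^sub>v w \<in> ?W" if "p \<in> carrier (sym_group m)" "w \<in> ?W" for p w
    using that intertwines_vec[of p w] sym_matrix_repD(1)[OF rep(1) that(1)]
      sym_matrix_repD(1)[OF rep(2) that(1)]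
    by auto
  ultimately have "?W = {0\<^sub>v d'} \<or> ?W = carrier_vec d'"
    by (rule irreducible_repD[OF assms(1)])
  moreover have "?W \<noteq> carrier_vec d'"
  proof
    assume W: "?W = carrier_vec d'"
    have "M *\<^sub>v v = 0\<^sub>v d" if "v \<in> carrier_vec d'" for v using W that by blast
    then have "M = 0\<^sub>m d d'"
      using M by (intro mat_eq_by_action[of _ d d']) auto
    with assms(2) show False by simp
  qed
  ultimately show ?thesis using assms by blast
qed

text \<open>The image is an invariant subspace, and it is nonzero because \<open>M\<close> is not
  zero.\<close>

lemma surjective:
  assumes "irreducible_rep m d \<rho>" "M \<noteq> 0\<^sub>m d d'" "w \<in> carrier_vec d"
  obtains v where "v \<in> carrier_vec d'" "M *\<^sub>v v = w"
proof -
  let ?W = "(\<lambda>v. M *\<^sub>v v) ` carrier_vec d'"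
  have "complex_subspace d ?W"
    unfolding complex_subspace_def
  proof (intro conjI ballI allI)
    show "?W \<subseteq> carrier_vec d" using M by auto
    have "M *\<^sub>v 0\<^sub>v d' = 0\<^sub>v d" using M by auto
    then show "0\<^sub>v d \<in> ?W" by (intro image_eqI[of _ _ "0\<^sub>v d'"]) auto
    show "x + y \<in> ?W" if xy: "x \<in> ?W" "y \<in> ?W" for x y
    proof -
      obtain v w where vw: "v \<in> carrier_vec d'" "w \<in> carrier_vec d'" "x = M *\<^sub>v v" "y = M *\<^sub>v w"
        using xy by auto
      then have "x + y = M *\<^sub>v (v + w)" using M by (simp add: mult_add_distrib_mat_vec)
      then show ?thesis using vw by auto
    qed
    show "c \<cdot>\<^sub>v x \<in> ?W" if x: "x \<in> ?W" for c x
    proof -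
      obtain v where v: "v \<in> carrier_vec d'" "x = M *\<^sub>v v" using x by auto
      then have "c \<cdot>\<^sub>v x = M *\<^sub>v (c \<cdot>\<^sub>v v)" using M by (simp add: mult_mat_vec)
      then show ?thesis using v by auto
    qed
  qed
  moreover have "\<rho> p *\<^sub>v w \<in> ?W" if pw: "p \<in> carrier (sym_group m)" "w \<in> ?W" for p w
  proof -
    obtain v where v: "v \<in> carrier_vec d'" "w = M *\<^sub>v v" using pw by auto
    then have "\<rho> p *\<^sub>v w = M *\<^sub>v (\<rho>' p *\<^sub>v v)" using intertwines_vec pw(1) by simp
    moreover have "\<rho>' p *\<^sub>v v \<in> carrier_vec d'"
      using sym_matrix_repD(1)[OF rep(2) pw(1)] v by simp
    ultimately show ?thesis by blast
  qed
  ultimately have "?W = {0\<^sub>v d} \<or> ?W = carrier_vec d"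
    by (rule irreducible_repD[OF assms(1)])
  moreover have "?W \<noteq> {0\<^sub>v d}"
  proof
    assume W: "?W = {0\<^sub>v d}"
    have "M *\<^sub>v v = 0\<^sub>v d" if "v \<in> carrier_vec d'" for v using W that by blast
    then have "M = 0\<^sub>m d d'"
      using M by (intro mat_eq_by_action[of _ d d']) auto
    with assms(2) show False by simp
  qed
  ultimately have "w \<in> ?W" using assms(3) by blast
  then show ?thesis using that by blast
qed

text \<open>A nonzero intertwiner between irreducible representations is invertible, and conjugate
  matrices have equal traces. The columns of the inverse \<open>N\<close> are preimages of the unit
  vectors.\<close>

lemma character_eq:
  assumes irr: "irreducible_rep m d \<rho>" "irreducible_rep m d' \<rho>'" and "M \<noteq> 0\<^sub>m d d'"
  shows "rep_character m d \<rho> = rep_character m d' \<rho>'"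
proof -
  have "\<forall>j. \<exists>v. v \<in> carrier_vec d' \<and> M *\<^sub>v v = unit_vec d j"
    using surjective[OF irr(1) assms(3)] unit_vec_carrier by metis
  then obtain v where v: "\<And>j. v j \<in> carrier_vec d'" "\<And>j. M *\<^sub>v v j = unit_vec d j" by metis
  define N where "N = Matrix.mat d' d (\<lambda>(i, j). v j $ i)"
  have N: "N \<in> carrier_mat d' d" by (simp add: N_def)
  have MN: "M * N = 1\<^sub>m d"
  proof (rule eq_matI)
    fix i j assume "i < dim_row (1\<^sub>m d :: complex Matrix.mat)" "j < dim_col (1\<^sub>m d :: complex Matrix.mat)"
    then have ij: "i < d" "j < d" by auto
    have "Matrix.col N j = v j" using v(1)[of j] ij by (intro eq_vecI) (auto simp: N_def)
    then have "(M * N) $$ (i, j) = (M *\<^sub>v v j) $ i" using M N ij by simp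
    then show "(M * N) $$ (i, j) = 1\<^sub>m d $$ (i, j)" using ij by (simp add: v(2))
  qed (use M N in auto)
  \<comment> \<open>The degrees \<open>d\<close> and \<open>d'\<close> are not yet known to agree,
    so \<open>N\<close> is shown to be a left inverse through the injectivity of
    \<open>M\<close>.\<close>
  have NM: "N * M = 1\<^sub>m d'"
  proof (rule mat_eq_by_action)
    fix w :: "complex Matrix.vec" assume w: "w \<in> carrier_vec d'"
    define z where "z = (N * M) *\<^sub>v w"
    have z: "z \<in> carrier_vec d'" using N M w by (simp add: z_def)
    have "M *\<^sub>v z = (M * N) *\<^sub>v (M *\<^sub>v w)" using N M w by (simp add: z_def)
    also have "\<dots> = M *\<^sub>v w" using M w by (simp add: MN)
    finally have "M *\<^sub>v (z - w) = 0\<^sub>v d"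
      using M w z by (simp add: mult_minus_distrib_mat_vec)
    then have "z - w = 0\<^sub>v d'" using kernel_trivial[OF irr(2) assms(3)] z w by simp
    then have "z $ a - w $ a = 0" if "a < d'" for a
      using w that by (metis index_minus_vec(1) index_zero_vec(1) carrier_vecD)
    then have "z = w" using z w by (intro eq_vecI) auto
    then show "(N * M) *\<^sub>v w = 1\<^sub>m d' *\<^sub>v w" using w by (simp add: z_def)
  qed (use M N in auto)
  have "(\<Sum>i<d. \<rho> p $$ (i, i)) = (\<Sum>i<d'. \<rho>' p $$ (i, i))" if p: "p \<in> carrier (sym_group m)" for p
  proof -
    have \<rho>: "\<rho> p \<in> carrier_mat d d" "\<rho>' p \<in> carrier_mat d' d'"
      using sym_matrix_repD(1) rep p by blast+
    have "\<rho> p = \<rho> p * (M * N)" using \<rho> by (simp add: MN)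
    also have "\<dots> = (\<rho> p * M) * N" using \<rho> M N by simp
    also have "\<dots> = M * (\<rho>' p * N)" using intertwines[OF p] \<rho> M N by simp
    finally have "(\<Sum>i<d. \<rho> p $$ (i, i)) = (\<Sum>i<d. (M * (\<rho>' p * N)) $$ (i, i))" by simp
    also have "\<dots> = (\<Sum>i<d'. ((\<rho>' p * N) * M) $$ (i, i))"
      using \<rho> M N by (intro trace_commute) auto
    also have "(\<rho>' p * N) * M = \<rho>' p"
      using \<rho> M N by (simp add: NM)
    finally show ?thesis .
  qed
  then show ?thesis by (auto simp: rep_character_def fun_eq_iff)
qed

end

text \<open>The average of \<open>\<rho> g * E * \<rho>' (inv g)\<close>, without the factor \<open>1 / m!\<close>, for the matrix unit \<open>E\<close>
  with entry \<open>1\<close> at \<open>(a, b)\<close>.\<close>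

definition averaged_unit ::
  "nat \<Rightarrow> nat \<Rightarrow> nat \<Rightarrow> ((nat \<Rightarrow> nat) \<Rightarrow> complex Matrix.mat) \<Rightarrow> ((nat \<Rightarrow> nat) \<Rightarrow> complex Matrix.mat)
     \<Rightarrow> nat \<Rightarrow> nat \<Rightarrow> complex Matrix.mat" where
  "averaged_unit m d d' \<rho> \<rho>' a b = Matrix.mat d d' (\<lambda>(i, j).
     \<Sum>g\<in>carrier (sym_group m). \<rho> g $$ (i, a) * \<rho>' (Hilbert_Choice.inv g) $$ (b, j))"

text \<open>The substitution of \<open>h \<circ> g\<close> for \<open>g\<close> in the sum over the
  group moves \<open>\<rho> h\<close> on the left to \<open>\<rho>' h\<close> on the right.\<close>

lemma averaged_unit_intertwiner:
  assumes rep: "sym_matrix_rep m d \<rho>" "sym_matrix_rep m d' \<rho>'" and ab: "a < d" "b < d'"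
  shows "intertwiner m d d' \<rho> \<rho>' (averaged_unit m d d' \<rho> \<rho>' a b)"
proof
  let ?G = "carrier (sym_group m)" and ?M = "averaged_unit m d d' \<rho> \<rho>' a b"
  show M: "?M \<in> carrier_mat d d'" by (simp add: averaged_unit_def)
  fix h assume h: "h \<in> ?G"
  note \<rho>h = sym_matrix_repD(1)[OF rep(1) h] and \<rho>'h = sym_matrix_repD(1)[OF rep(2) h]
  show "\<rho> h * ?M = ?M * \<rho>' h"
  proof (rule eq_matI)
    fix i j assume "i < dim_row (?M * \<rho>' h)" "j < dim_col (?M * \<rho>' h)"
    then have ij: "i < d" "j < d'" using M \<rho>'h by auto
    have "(\<rho> h * ?M) $$ (i, j) = (\<Sum>k<d. \<rho> h $$ (i, k) * ?M $$ (k, j))"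
      by (rule mult_mat_index[OF \<rho>h M ij])
    also have "\<dots> = (\<Sum>k<d. \<Sum>g\<in>?G. \<rho> h $$ (i, k) * \<rho> g $$ (k, a) * \<rho>' (Hilbert_Choice.inv g) $$ (b, j))"
      using ij by (simp add: averaged_unit_def sum_distrib_left mult.assoc)
    also have "\<dots> = (\<Sum>g\<in>?G. (\<Sum>k<d. \<rho> h $$ (i, k) * \<rho> g $$ (k, a)) * \<rho>' (Hilbert_Choice.inv g) $$ (b, j))"
      by (subst sum.swap) (simp add: sum_distrib_right)
    also have "\<dots> = (\<Sum>g\<in>?G. \<rho> (h \<circ> g) $$ (i, a) * \<rho>' (Hilbert_Choice.inv g) $$ (b, j))"
      using mult_mat_index[OF \<rho>h sym_matrix_repD(1)[OF rep(1)] ij(1) ab(1)] sym_matrix_repD(3)[OF rep(1) h]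
      by (intro sum.cong) auto
    \<comment> \<open>Now the summand depends on \<open>g\<close> only through
      \<open>h \<circ> g\<close>, so the sum can be translated.\<close>
    also have "\<dots> = (\<Sum>g\<in>?G. \<rho> (h \<circ> g) $$ (i, a) * \<rho>' (Hilbert_Choice.inv (h \<circ> g) \<circ> h) $$ (b, j))"
    proof (intro sum.cong refl)
      fix g assume g: "g \<in> ?G"
      then have "Hilbert_Choice.inv (h \<circ> g) \<circ> h = Hilbert_Choice.inv g"
        using h by (simp add: carrier_sym_group o_inv_distrib permutes_bij comp_assoc permutes_inv_o)
      then show "\<rho> (h \<circ> g) $$ (i, a) * \<rho>' (Hilbert_Choice.inv g) $$ (b, j) =
        \<rho> (h \<circ> g) $$ (i, a) * \<rho>' (Hilbert_Choice.inv (h \<circ> g) \<circ> h) $$ (b, j)" by simp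
    qed
    also have "\<dots> = (\<Sum>g\<in>?G. \<rho> g $$ (i, a) * \<rho>' (Hilbert_Choice.inv g \<circ> h) $$ (b, j))"
      by (rule sum_sym_group_translate[OF h, of "\<lambda>g. \<rho> g $$ (i, a) * \<rho>' (Hilbert_Choice.inv g \<circ> h) $$ (b, j)"])
    also have "\<dots> = (\<Sum>g\<in>?G. \<rho> g $$ (i, a) * (\<Sum>k<d'. \<rho>' (Hilbert_Choice.inv g) $$ (b, k) * \<rho>' h $$ (k, j)))"
      using mult_mat_index[OF sym_matrix_repD(1)[OF rep(2)] \<rho>'h ab(2) ij(2)]
        sym_matrix_repD(3)[OF rep(2) _ h] sym_group_closed(2)
      by (intro sum.cong) auto
    also have "\<dots> = (\<Sum>g\<in>?G. \<Sum>k<d'. \<rho> g $$ (i, a) * \<rho>' (Hilbert_Choice.inv g) $$ (b, k) * \<rho>' h $$ (k, j))"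
      by (simp add: sum_distrib_left mult.assoc)
    also have "\<dots> = (\<Sum>k<d'. ?M $$ (i, k) * \<rho>' h $$ (k, j))"
      using ij by (subst sum.swap) (simp add: averaged_unit_def sum_distrib_right)
    also have "\<dots> = (?M * \<rho>' h) $$ (i, j)"
      by (rule mult_mat_index[OF M \<rho>'h ij, symmetric])
    finally show "(\<rho> h * ?M) $$ (i, j) = (?M * \<rho>' h) $$ (i, j)" .
  qed (use M \<rho>h \<rho>'h in auto)
qed (rule rep)+

section \<open>Orthogonality of irreducible characters\<close>

definition char_inner ::
  "nat \<Rightarrow> ((nat \<Rightarrow> nat) \<Rightarrow> complex) \<Rightarrow> ((nat \<Rightarrow> nat) \<Rightarrow> complex) \<Rightarrow> complex" where
  "char_inner m f h = (\<Sum>g\<in>carrier (sym_group m). f g * h (Hilbert_Choice.inv g))"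

text \<open>In \<open>char_inner\<close> the inverse stands in for complex conjugation. The product
  of the diagonal entries at \<open>i\<close> and \<open>j\<close> is the \<open>(i, j)\<close>
  entry of one summand of the averaged matrix unit at \<open>(i, j)\<close>.\<close>

lemma char_inner_rep_character:
  "char_inner m (rep_character m d \<rho>) (rep_character m d' \<rho>') =
     (\<Sum>i<d. \<Sum>j<d'. averaged_unit m d d' \<rho> \<rho>' i j $$ (i, j))"
proof -
  have "char_inner m (rep_character m d \<rho>) (rep_character m d' \<rho>') =
    (\<Sum>g\<in>carrier (sym_group m). \<Sum>i<d. \<Sum>j<d'. \<rho> g $$ (i, i) * \<rho>' (Hilbert_Choice.inv g) $$ (j, j))"
    unfolding char_inner_def rep_character_def
    by (intro sum.cong refl) (simp add: sym_group_closed(2) sum_product)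
  also have "\<dots> = (\<Sum>i<d. \<Sum>g\<in>carrier (sym_group m). \<Sum>j<d'. \<rho> g $$ (i, i) * \<rho>' (Hilbert_Choice.inv g) $$ (j, j))"
    by (rule sum.swap)
  also have "\<dots> = (\<Sum>i<d. \<Sum>j<d'. \<Sum>g\<in>carrier (sym_group m). \<rho> g $$ (i, i) * \<rho>' (Hilbert_Choice.inv g) $$ (j, j))"
    by (rule sum.cong[OF refl], rule sum.swap)
  finally show ?thesis by (simp add: averaged_unit_def)
qed

text \<open>By \<open>character_eq\<close> a nonzero averaged matrix unit would force the characters
  to be equal.\<close>

lemma char_inner_distinct:
  assumes irr: "irreducible_rep m d \<rho>" "irreducible_rep m d' \<rho>'"
    and ne: "rep_character m d \<rho> \<noteq> rep_character m d' \<rho>'"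
  shows "char_inner m (rep_character m d \<rho>) (rep_character m d' \<rho>') = 0"
proof -
  have rep: "sym_matrix_rep m d \<rho>" "sym_matrix_rep m d' \<rho>'"
    using irr by (auto simp: irreducible_rep_def)
  have "averaged_unit m d d' \<rho> \<rho>' i j = 0\<^sub>m d d'" if "i < d" "j < d'" for i j
    using intertwiner.character_eq[OF averaged_unit_intertwiner[OF rep that] irr] ne by blast
  then show ?thesis by (simp add: char_inner_rep_character)
qed

text \<open>Over the complex numbers \<open>M\<close> has an eigenvalue; the eigenspace is invariant
  and nonzero, hence everything.\<close>

lemma intertwiner_scalar:
  assumes "intertwiner m d d \<rho> \<rho> M" and irr: "irreducible_rep m d \<rho>"
  obtains c where "M = c \<cdot>\<^sub>m 1\<^sub>m d"
proof -
  interpret intertwiner m d d \<rho> \<rho> M by fact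
  have d: "d > 0" using irr by (simp add: irreducible_rep_def)
  obtain c where "eigenvalue M c"
    using spectrum_non_empty[OF M d] by (auto simp: spectrum_def)
  then obtain v where v: "v \<in> carrier_vec d" "v \<noteq> 0\<^sub>v d" "M *\<^sub>v v = c \<cdot>\<^sub>v v"
    using M by (auto simp: eigenvalue_def eigenvector_def)
  let ?W = "{v \<in> carrier_vec d. M *\<^sub>v v = c \<cdot>\<^sub>v v}"
  have "complex_subspace d ?W"
    using M by (auto simp: complex_subspace_def mult_add_distrib_mat_vec mult_mat_vec
      smult_add_distrib_vec smult_smult_assoc mult.commute)
  moreover have "\<rho> p *\<^sub>v w \<in> ?W" if "p \<in> carrier (sym_group m)" "w \<in> ?W" for p w
    using that intertwines_vec[of p w] sym_matrix_repD(1)[OF rep(1) that(1)]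
    by (auto simp: mult_mat_vec)
  ultimately have "?W = {0\<^sub>v d} \<or> ?W = carrier_vec d"
    by (rule irreducible_repD[OF irr])
  moreover have "v \<in> ?W" using v by blast
  ultimately have W: "?W = carrier_vec d" using v by blast
  have "M = c \<cdot>\<^sub>m 1\<^sub>m d"
  proof (rule mat_eq_by_action[OF M])
    fix w :: "complex Matrix.vec" assume w: "w \<in> carrier_vec d"
    then have "M *\<^sub>v w = c \<cdot>\<^sub>v w" using W by blast
    also have "\<dots> = (c \<cdot>\<^sub>m 1\<^sub>m d) *\<^sub>v w"
      using w by (intro eq_vecI) auto
    finally show "M *\<^sub>v w = (c \<cdot>\<^sub>m 1\<^sub>m d) *\<^sub>v w" .
  qed simp
  then show ?thesis using that by blast
qed

text \<open>Averaged matrix units are scalar matrices, so only those at \<open>(i, i)\<close>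
  contribute. Each of these has the order of the group as its trace, and so the inner product is
  that order.\<close>

lemma char_inner_self:
  assumes irr: "irreducible_rep m d \<rho>"
  shows "char_inner m (rep_character m d \<rho>) (rep_character m d \<rho>) \<noteq> 0"
proof -
  let ?G = "carrier (sym_group m)"
  have rep: "sym_matrix_rep m d \<rho>" and d: "d > 0"
    using irr by (auto simp: irreducible_rep_def)
  let ?M = "averaged_unit m d d \<rho> \<rho>"
  have "\<exists>c. ?M i j = c \<cdot>\<^sub>m 1\<^sub>m d" if "i < d" "j < d" for i j
    using intertwiner_scalar[OF averaged_unit_intertwiner[OF rep rep that] irr] by blast
  then obtain c where c: "\<And>i j. i < d \<Longrightarrow> j < d \<Longrightarrow> ?M i j = c i j \<cdot>\<^sub>m 1\<^sub>m d" by metis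
  have trace: "of_nat d * c a a = of_nat (card ?G)" if a: "a < d" for a
  proof -
    have "of_nat d * c a a = (\<Sum>i<d. ?M a a $$ (i, i))"
      using a by (simp add: c)
    also have "\<dots> = (\<Sum>i<d. \<Sum>g\<in>?G. \<rho> (Hilbert_Choice.inv g) $$ (a, i) * \<rho> g $$ (i, a))"
      by (simp add: averaged_unit_def mult.commute)
    also have "\<dots> = (\<Sum>g\<in>?G. \<Sum>i<d. \<rho> (Hilbert_Choice.inv g) $$ (a, i) * \<rho> g $$ (i, a))"
      by (rule sum.swap)
    also have "\<dots> = (\<Sum>g\<in>?G. 1)"
    proof (intro sum.cong refl)
      fix g assume g: "g \<in> ?G"
      have "(\<Sum>i<d. \<rho> (Hilbert_Choice.inv g) $$ (a, i) * \<rho> g $$ (i, a)) =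
        (\<rho> (Hilbert_Choice.inv g) * \<rho> g) $$ (a, a)"
        using mult_mat_index[of "\<rho> (Hilbert_Choice.inv g)" d d "\<rho> g" d a a] a
          sym_matrix_repD(1)[OF rep] g sym_group_closed(2)[OF g] by simp
      also have "\<rho> (Hilbert_Choice.inv g) * \<rho> g = 1\<^sub>m d"
        using sym_matrix_repD(2,3)[OF rep] g sym_group_closed(2,3)[OF g] by metis
      finally show "(\<Sum>i<d. \<rho> (Hilbert_Choice.inv g) $$ (a, i) * \<rho> g $$ (i, a)) = 1" using a by simp
    qed
    finally show ?thesis by simp
  qed
  have "of_nat d * char_inner m (rep_character m d \<rho>) (rep_character m d \<rho>) =
    of_nat d * (\<Sum>i<d. \<Sum>j<d. if j = i then c i i else 0)"
    unfolding char_inner_rep_character by (intro arg_cong2[of _ _ _ _ "(*)"] sum.cong refl) (auto simp: c)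
  also have "\<dots> = (\<Sum>i<d. of_nat d * c i i)"
    by (simp add: sum_distrib_left)
  also have "\<dots> = of_nat d * of_nat (card ?G)" by (simp add: trace)
  finally have "of_nat d * char_inner m (rep_character m d \<rho>) (rep_character m d \<rho>) =
    (of_nat (d * card ?G) :: complex)" by simp
  moreover have "card ?G > 0"
    using id_in_sym_group finite_carrier_sym_group by (auto simp: card_gt_0_iff)
  ultimately show ?thesis using d by auto
qed

section \<open>Finiteness of the set of partitions\<close>

lemma diagram_rectangle_subset:
  assumes "antimono \<alpha>" "(i, j) \<in> diagram \<alpha>"
  shows "{..i} \<times> {..j} \<subseteq> diagram \<alpha>"
proof
  fix b assume b: "b \<in> {..i} \<times> {..j}"
  then have "\<alpha> i \<le> \<alpha> (fst b)" "snd b \<le> j" using assms(1) by (auto simp: antimono_def)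
  then show "b \<in> diagram \<alpha>" using assms(2) by (cases b) (simp add: diagram_def)
qed

lemma finite_diagram:
  assumes "is_partition \<alpha>"
  shows "finite (diagram \<alpha>)"
proof -
  have "diagram \<alpha> = Sigma {i. \<alpha> i \<noteq> 0} (\<lambda>i. {..<\<alpha> i})"
    by (auto simp: diagram_def)
  then show ?thesis using assms by (simp add: is_partition_def)
qed

text \<open>A diagram that contains \<open>(i, j)\<close> contains a rectangle of
  \<open>Suc i * Suc j\<close> boxes, which confines diagrams with \<open>m\<close> boxes to a fixed
  square.\<close>

lemma finite_partitions_of: "finite (partitions_of m)"
proof (rule finite_imageD)
  show "finite (diagram ` partitions_of m)"
  proof (rule finite_subset)
    show "diagram ` partitions_of m \<subseteq> Pow ({..m} \<times> {..m})"
    proof clarify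
      fix \<alpha> i j assume \<alpha>: "\<alpha> \<in> partitions_of m" and ij: "(i, j) \<in> diagram \<alpha>"
      then have "card ({..i} \<times> {..j}) \<le> m"
        using card_mono[OF finite_diagram diagram_rectangle_subset[OF _ ij]]
        by (auto simp: partitions_of_def is_partition_def)
      then have "Suc i * Suc j \<le> m" by (simp add: card_cartesian_product)
      then have "i \<le> m \<and> j \<le> m" by auto
      then show "i \<in> {..m} \<and> j \<in> {..m}" by simp
    qed
  qed simp
  show "inj_on diagram (partitions_of m)"
  proof (rule inj_onI, rule ext)
    fix \<alpha> \<beta> i assume "diagram \<alpha> = diagram \<beta>"
    then have "\<And>j. j < \<alpha> i \<longleftrightarrow> j < \<beta> i" by (auto simp: diagram_def set_eq_iff)
    then show "\<alpha> i = \<beta> i" by (metis nat_neq_iff)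
  qed
qed

section \<open>Uniqueness of coefficients\<close>

lemma coeff_in_eqI:
  assumes "inj_on comb (int_families I)" "a \<in> int_families I"
  shows "coeff_in comb I (comb a) = a"
  unfolding coeff_in_def
proof (rule the_equality)
  show "x = a" if "x \<in> int_families I \<and> comb x = comb a" for x
    using inj_onD[OF assms(1), of x a] that assms(2) by blast
qed (use assms(2) in blast)

text \<open>By orthogonality, pairing a combination with \<open>chi \<beta>\<close> isolates its
  coefficient at \<open>\<beta>\<close>, multiplied by a nonzero number.\<close>

lemma inj_on_character_combination:
  assumes "irr_char_labelling chi"
  shows "inj_on (\<lambda>a p. \<Sum>\<alpha>\<in>partitions_of m. of_int (a \<alpha>) * chi \<alpha> p) (int_families (partitions_of m))"
proof (rule inj_onI)
  let ?P = "partitions_of m"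
  have bij: "bij_betw chi ?P (irreducible_characters m)"
    by (rule conjunct1[OF spec[OF assms[unfolded irr_char_labelling_def]]])
  have irr: "\<exists>d \<rho>. chi \<alpha> = rep_character m d \<rho> \<and> irreducible_rep m d \<rho>" if "\<alpha> \<in> ?P" for \<alpha>
    using bij_betwE[OF bij] that by (auto simp: irreducible_characters_def)
  have self: "char_inner m (chi \<alpha>) (chi \<alpha>) \<noteq> 0" if "\<alpha> \<in> ?P" for \<alpha>
    using irr[OF that] char_inner_self by auto
  have orth: "char_inner m (chi \<alpha>) (chi \<beta>) = 0" if ab: "\<alpha> \<in> ?P" "\<beta> \<in> ?P" "\<alpha> \<noteq> \<beta>" for \<alpha> \<beta>
  proof -
    obtain d \<rho> d' \<rho>' where chi: "chi \<alpha> = rep_character m d \<rho>" "irreducible_rep m d \<rho>"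
      "chi \<beta> = rep_character m d' \<rho>'" "irreducible_rep m d' \<rho>'"
      using irr[OF ab(1)] irr[OF ab(2)] by blast
    have "chi \<alpha> \<noteq> chi \<beta>"
      using ab inj_on_contraD[OF bij_betw_imp_inj_on[OF bij], of \<alpha> \<beta>] by simp
    then show ?thesis
      unfolding chi(1,3) by (rule char_inner_distinct[OF chi(2,4)])
  qed
  fix a b
  assume a: "a \<in> int_families ?P" and b: "b \<in> int_families ?P"
    and eq: "(\<lambda>p. \<Sum>\<alpha>\<in>?P. of_int (a \<alpha>) * chi \<alpha> p) = (\<lambda>p. \<Sum>\<alpha>\<in>?P. of_int (b \<alpha>) * chi \<alpha> p)"
  show "a = b"
  proof
    fix \<beta>
    show "a \<beta> = b \<beta>"
    proof (cases "\<beta> \<in> ?P")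
      case True
      have coeff: "char_inner m (\<lambda>p. \<Sum>\<alpha>\<in>?P. of_int (a \<alpha>) * chi \<alpha> p) (chi \<beta>) =
        of_int (a \<beta>) * char_inner m (chi \<beta>) (chi \<beta>)" for a
      proof -
        have "char_inner m (\<lambda>p. \<Sum>\<alpha>\<in>?P. of_int (a \<alpha>) * chi \<alpha> p) (chi \<beta>) =
          (\<Sum>\<alpha>\<in>?P. of_int (a \<alpha>) * char_inner m (chi \<alpha>) (chi \<beta>))"
          unfolding char_inner_def sum_distrib_right sum_distrib_left
          by (subst sum.swap) (simp add: mult.assoc)
        also have "\<dots> = (\<Sum>\<alpha>\<in>?P. if \<alpha> = \<beta> then of_int (a \<beta>) * char_inner m (chi \<beta>) (chi \<beta>) else 0)"
        proof (intro sum.cong refl)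
          fix \<alpha> assume "\<alpha> \<in> ?P"
          then show "of_int (a \<alpha>) * char_inner m (chi \<alpha>) (chi \<beta>) =
            (if \<alpha> = \<beta> then of_int (a \<beta>) * char_inner m (chi \<beta>) (chi \<beta>) else 0)"
            using orth[OF _ True] by simp
        qed
        finally show ?thesis using True finite_partitions_of by simp
      qed
      have "of_int (a \<beta>) * char_inner m (chi \<beta>) (chi \<beta>) =
        char_inner m (\<lambda>p. \<Sum>\<alpha>\<in>?P. of_int (a \<alpha>) * chi \<alpha> p) (chi \<beta>)"
        by (rule coeff[of a, symmetric])
      also have "\<dots> = of_int (b \<beta>) * char_inner m (chi \<beta>) (chi \<beta>)"
        unfolding eq by (rule coeff[of b])
      finally have "of_int (a \<beta>) * char_inner m (chi \<beta>) (chi \<beta>) =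
        of_int (b \<beta>) * char_inner m (chi \<beta>) (chi \<beta>)" .
      then show ?thesis using self[OF True] by simp
    qed (use a b in \<open>auto simp: int_families_def\<close>)
  qed
qed


section \<open>Comparison of the coefficients\<close>

text \<open>A nonzero coefficient provides a chain, and its strip sizes, which are the parts of
  \<open>\<alpha>\<close>, telescope to the size of \<open>\<Lambda>/\<mu>\<close>.\<close>

lemma partitions_of_if_lr_coeff_nonzero:
  assumes in_rect: "\<mu> \<in> partitions_in_rect k l" "\<Lambda> \<in> partitions_in_rect k l" "\<alpha> \<in> partitions_in_rect k l"
    and nonzero: "lr_coeff \<Lambda> \<mu> \<alpha> \<noteq> 0"
  shows "\<alpha> \<in> partitions_of (card (skew_diagram \<Lambda> \<mu>))"
proof -
  have sub: "diagram \<mu> \<subseteq> diagram \<Lambda>"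
    using nonzero by (auto simp: lr_coeff_def split: if_splits)
  have "card {c \<in> strip_chains k l l (\<lambda>i. int (\<alpha> i)) \<mu> \<Lambda>. good c} \<noteq> 0"
    using nonzero lr_coeff_eq_jacobi_trudi[OF in_rect] jacobi_trudi_eq_card[OF in_rect] by simp
  then obtain c where c: "c \<in> strip_chains k l l (\<lambda>i. int (\<alpha> i)) \<mu> \<Lambda>"
    by (metis (no_types, lifting) card.empty mem_Collect_eq ex_in_conv)
  have "int (card (diagram \<alpha>)) = ptn_size l \<alpha>"
    using int_card_skew_diagram[of "\<lambda>_. 0" \<alpha> k l] in_rect(3)
    by (simp add: skew_diagram_def diagram_def ptn_size_def)
  also have "\<dots> = (\<Sum>i<l. ptn_size l (c (Suc i)) - ptn_size l (c i))"
    using c unfolding ptn_size_def[of l \<alpha>] by (intro sum.cong) (auto simp: strip_chains_def)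
  also have "\<dots> = ptn_size l (c l) - ptn_size l (c 0)"
    by (rule sum_lessThan_telescope[of "\<lambda>i. ptn_size l (c i)"])
  also have "\<dots> = ptn_size l \<Lambda> - ptn_size l \<mu>"
    using c by (simp add: strip_chains_def)
  also have "\<dots> = int (card (skew_diagram \<Lambda> \<mu>))"
    by (rule int_card_skew_diagram[OF sub in_rect(2), symmetric])
  finally show ?thesis
    using in_rect(3) by (simp add: partitions_of_def partitions_in_rect_def)
qed

text \<open>The structure constants are the third condition of \<open>schubert_classes\<close>; the
  basis condition makes the coefficients unique.\<close>

lemma schubert_coeff_mult:
  fixes \<sigma> :: "ptn \<Rightarrow> (complex ^ 'n) set cochain set"
  assumes \<sigma>: "schubert_classes k l \<sigma>"
    and in_rect: "\<mu> \<in> partitions_in_rect k l" "\<nu> \<in> partitions_in_rect k l" "\<Lambda> \<in> partitions_in_rect k l"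
  shows "schubert_coeff k l \<sigma>
    (\<sigma> \<mu> \<otimes>\<^bsub>cohomology_ring (grassmannian l :: (complex ^ 'n) set topology)\<^esub> \<sigma> \<nu>) \<Lambda> = int (lr_coeff \<Lambda> \<mu> \<nu>)"
proof -
  let ?a = "\<lambda>\<alpha>. if \<alpha> \<in> partitions_in_rect k l then int (lr_coeff \<alpha> \<mu> \<nu>) else 0"
  note basis = conjunct1[OF conjunct2[OF \<sigma>[unfolded schubert_classes_def]]]
    and mult = conjunct2[OF conjunct2[OF \<sigma>[unfolded schubert_classes_def]]]
  have "?a \<in> int_families (partitions_in_rect k l)" by (simp add: int_families_def)
  then have "schubert_coeff k l \<sigma> (schubert_combination k l \<sigma> ?a) = ?a"
    unfolding schubert_coeff_def by (rule coeff_in_eqI[OF bij_betw_imp_inj_on[OF basis]])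
  then show ?thesis
    using bspec[OF bspec[OF mult in_rect(1)] in_rect(2)] in_rect(3) by simp
qed

lemma character_coeff_skew_character:
  assumes "irr_char_labelling chi"
  shows "character_coeff chi (card (skew_diagram \<Lambda> \<mu>)) (skew_character chi \<Lambda> \<mu>) \<alpha> =
    (if \<alpha> \<in> partitions_of (card (skew_diagram \<Lambda> \<mu>)) then int (lr_coeff \<Lambda> \<mu> \<alpha>) else 0)"
proof -
  let ?P = "partitions_of (card (skew_diagram \<Lambda> \<mu>))"
  define a where "a = (\<lambda>\<alpha>. if \<alpha> \<in> ?P then int (lr_coeff \<Lambda> \<mu> \<alpha>) else 0)"
  have "a \<in> int_families ?P" by (simp add: int_families_def a_def)
  then have "character_coeff chi (card (skew_diagram \<Lambda> \<mu>)) (\<lambda>p. \<Sum>\<alpha>\<in>?P. of_int (a \<alpha>) * chi \<alpha> p) = a"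
    unfolding character_coeff_def by (rule coeff_in_eqI[OF inj_on_character_combination[OF assms]])
  moreover have "skew_character chi \<Lambda> \<mu> = (\<lambda>p. \<Sum>\<alpha>\<in>?P. of_int (a \<alpha>) * chi \<alpha> p)"
    by (simp add: fun_eq_iff skew_character_def a_def)
  ultimately show ?thesis by (simp add: a_def)
qed

theorem theorem4p2:
  fixes k l :: nat
    and \<mu> \<nu> lam :: ptn
    and \<sigma> :: "ptn \<Rightarrow> (complex ^ 'n) set cochain set"
    and chi :: "ptn \<Rightarrow> (nat \<Rightarrow> nat) \<Rightarrow> complex"
  assumes "k > 0" and "l > 0" and "CARD('n) = k + l"
    and "\<mu> \<in> partitions_in_rect k l"
    and "\<nu> \<in> partitions_in_rect k l"
    and "lam \<in> partitions_in_rect k l"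
    and "diagram \<mu> \<subseteq> diagram (rect_compl k l \<nu>)"
    and "\<mu> \<noteq> rect_compl k l \<nu>"
    and "schubert_classes k l \<sigma>"
    and "irr_char_labelling chi"
  shows "schubert_coeff k l \<sigma>
           (\<sigma> \<mu> \<otimes>\<^bsub>cohomology_ring (grassmannian l :: (complex ^ 'n) set topology)\<^esub> \<sigma> \<nu>) lam
         = character_coeff chi (card (skew_diagram (rect_compl k l \<nu>) \<mu>))
             (skew_character chi (rect_compl k l \<nu>) \<mu>) (rect_compl k l lam)"
proof -
  note in_rect = assms(4,5,6)
  have coeffs: "lr_coeff lam \<mu> \<nu> = lr_coeff (rect_compl k l \<nu>) \<mu> (rect_compl k l lam)"
    by (rule lr_coeff_rect_compl[OF \<open>l > 0\<close> in_rect])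
  \<comment> \<open>For a complement of the wrong size the character coefficient is \<open>0\<close>
    by convention, so the Littlewood-Richardson coefficient has to vanish as well.\<close>
  have "lr_coeff (rect_compl k l \<nu>) \<mu> (rect_compl k l lam) = 0"
    if "rect_compl k l lam \<notin> partitions_of (card (skew_diagram (rect_compl k l \<nu>) \<mu>))"
    using partitions_of_if_lr_coeff_nonzero[OF in_rect(1) rect_compl_in_rect[OF in_rect(2)]
        rect_compl_in_rect[OF in_rect(3)]] that by blast
  then show ?thesis
    unfolding schubert_coeff_mult[OF assms(9) in_rect] character_coeff_skew_character[OF assms(10)]
    using coeffs by simp
qed

end
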